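(* Let $\triangle ABC$ be a triangle in $\mathbb{S}^2$, $\mathbb{E}^2$, or $\mathbb{H}^2$. If $A_1,\ldots,A_n$; $B_1,\ldots,B_n$; and $C_1,\ldots,C_n$ are $n$-tuples of points lying along $\overleftrightarrow{BC}$, $\overleftrightarrow{AC}$, and $\overleftrightarrow{AB}$ respectively, then these points lie on a curve of degree $n$ if and only if $$\prod_{k=1}^n \frac{\operatorname{gsin}(AB_k)}{\operatorname{gsin}(B_kC)}\cdot\frac{\operatorname{gsin}(BC_k)}{\operatorname{gsin}(C_kA)}\cdot\frac{\operatorname{gsin}(CA_k)}{\operatorname{gsin}(A_kB)}=(-1)^n.$$
   Context: $\mathbb{E}^2$ is the Euclidean plane (curvature $K=0$). $\mathbb{S}^2$ is the unit sphere $x^2+y^2+z^2=1$ in $\mathbb{R}^3$ with the induced metric ($K=1$). $\mathbb{H}^2$ is the upper sheet $x^2+y^2-z^2=-1$, $z>0$, with the metric induced by $ds^2=dx^2+dy^2-dz^2$ ($K=-1$). A line (geodesic) is an ordinary line in $\mathbb{E}^2$, and the intersection of the surface with a plane through the origin in $\mathbb{S}^2$ or $\mathbb{H}^2$. Two points of $\mathbb{S}^2$ are antipodal if they are the two intersection points of $\mathbb{S}^2$ with a line through the origin. A triangle is given by three non-collinear points (in $\mathbb{S}^2$, no two antipodal, with sides the shorter segments); $\overleftrightarrow{XY}$ is the full line through $X$ and $Y$, taken with an orientation. The generalized sine is $\operatorname{gsin}(x)=x-\frac{Kx^3}{3!}+\frac{K^2x^5}{5!}-\cdots$, i.e. $\sin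 x$ in $\mathbb{S}^2$, $x$ in $\mathbb{E}^2$, $\sinh x$ in $\mathbb{H}^2$. For points $X,Y$ on an oriented line, $\operatorname{gsin}(XY)$ is the generalized sine of the signed distance from $X$ to $Y$ along that oriented line (in $\mathbb{S}^2$ both ways of travelling from $X$ to $Y$ give the same value). For a plane $w\subset\mathbb{R}^3$ not containing the origin, central projection from $\mathbb{S}^2$ or $\mathbb{H}^2$ to $w$ sends a point $P$ to the intersection with $w$ of the line through the origin and $P$ (when it exists). A curve in $\mathbb{S}^2$ or $\mathbb{H}^2$ has degree $n$ if and only if its central projection onto a plane $w$ is a degree $n$ (algebraic) curve on the plane $w$.
   Formalization: "Lie on a curve of degree n" is taken to mean that the curve contains none of the three side lines, and that repeated points (or antipodal ones on the sphere) count with intersection multiplicity; otherwise the claim fails (e.g. three side lines for n = 3). Denominators are assumed nonzero. *)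

theory Defs
  imports "HOL-Analysis.Analysis" "HOL-Computational_Algebra.Polynomial"
begin

datatype geometry = Spherical | Euclidean | Hyperbolic

primrec curvature :: "geometry \<Rightarrow> real" where
  "curvature Spherical = 1"
| "curvature Euclidean = 0"
| "curvature Hyperbolic = - 1"

text \<open>
  The Euclidean plane is realised as the plane \<open>z = 1\<close> of three-space, so that in all three cases
  the lines are the nonempty intersections with planes through the origin.
\<close>

primrec surface :: "geometry \<Rightarrow> (real^3) set" where
  "surface Spherical = {p. (p$1)^2 + (p$2)^2 + (p$3)^2 = 1}"
| "surface Euclidean = {p. p$3 = 1}"
| "surface Hyperbolic = {p. (p$1)^2 + (p$2)^2 - (p$3)^2 = - 1 \<and> p$3 > 0}"

primrec metric :: "geometry \<Rightarrow> real^3 \<Rightarrow> real^3 \<Rightarrow> real" where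
  "metric Spherical u v = u \<bullet> v"
| "metric Euclidean u v = u \<bullet> v"
| "metric Hyperbolic u v = u$1 * v$1 + u$2 * v$2 - u$3 * v$3"

definition is_line :: "geometry \<Rightarrow> (real^3) set \<Rightarrow> bool" where
  "is_line G L \<longleftrightarrow> L \<noteq> {} \<and> (\<exists>N. N \<noteq> 0 \<and> L = surface G \<inter> {X. N \<bullet> X = 0})"

definition is_triangle :: "geometry \<Rightarrow> real^3 \<Rightarrow> real^3 \<Rightarrow> real^3 \<Rightarrow> bool" where
  "is_triangle G A B C \<longleftrightarrow>
     {A, B, C} \<subseteq> surface G \<and>
     \<not> (\<exists>L. is_line G L \<and> {A, B, C} \<subseteq> L) \<and>
     (G = Spherical \<longrightarrow> A \<noteq> - B \<and> B \<noteq> - C \<and> C \<noteq> - A)"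

text \<open>
  An oriented line is given by a parametrisation of the whole line by arc length (in the
  induced metric), running in the direction of the orientation.
\<close>

definition oriented_line :: "geometry \<Rightarrow> (real \<Rightarrow> real^3) \<Rightarrow> bool" where
  "oriented_line G \<gamma> \<longleftrightarrow>
     is_line G (range \<gamma>) \<and>
     (\<exists>\<gamma>'. continuous_on UNIV \<gamma>' \<and>
        (\<forall>t. (\<gamma> has_vector_derivative \<gamma>' t) (at t) \<and> metric G (\<gamma>' t) (\<gamma>' t) = 1))"

text \<open>
  On the sphere the signed distance is determined only up to multiples of \<open>2 * pi\<close>; its
  generalised sine does not depend on the choice.
\<close>

definition signed_dist :: "(real \<Rightarrow> real^3) \<Rightarrow> real^3 \<Rightarrow> real^3 \<Rightarrow> real" where
  "signed_dist \<gamma> X Y = (SOME d. \<exists>s. \<gamma> s = X \<and> \<gamma> (s + d) = Y)"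

definition gsin :: "real \<Rightarrow> real \<Rightarrow> real" where
  "gsin K x = (\<Sum>k. (- K) ^ k * x ^ (2 * k + 1) / fact (2 * k + 1))"

definition gsin_along :: "geometry \<Rightarrow> (real \<Rightarrow> real^3) \<Rightarrow> real^3 \<Rightarrow> real^3 \<Rightarrow> real" where
  "gsin_along G \<gamma> X Y = gsin (curvature G) (signed_dist \<gamma> X Y)"

lemma gsin_spherical: "gsin (curvature Spherical) = sin"
proof
  fix x :: real
  show "gsin (curvature Spherical) x = sin x"
    using sums_unique[OF sin_paired[of x]] by (simp add: gsin_def mult_ac)
qed

lemma gsin_euclidean: "gsin (curvature Euclidean) x = x"
proof -
  have "(\<lambda>k. (- 0) ^ k * x ^ (2 * k + 1) / fact (2 * k + 1)) sums
        (\<Sum>k\<in>{0::nat}. (- 0) ^ k * x ^ (2 * k + 1) / fact (2 * k + 1))"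
    by (rule sums_finite) auto
  then show ?thesis
    by (simp add: gsin_def sums_iff)
qed

lemma gsin_hyperbolic: "gsin (curvature Hyperbolic) = sinh"
proof
  fix x :: real
  have "(\<lambda>n. if even n then 0 else x ^ n /\<^sub>R fact n) sums sinh x"
    by (rule sinh_converges)
  then have "(\<lambda>k. \<Sum>n = k * 2..<k * 2 + 2. if even n then 0 else x ^ n /\<^sub>R fact n) sums sinh x"
    by (rule sums_group) simp
  then have "(\<lambda>k. x ^ (2 * k + 1) / fact (2 * k + 1)) sums sinh x"
    by (simp add: field_simps)
  then show "gsin (curvature Hyperbolic) x = sinh x"
    by (simp add: gsin_def sums_iff)
qed

text \<open>
  The coefficient of \<open>x ^ i * y ^ j\<close> in a bivariate polynomial \<open>f\<close> is \<open>coeff (coeff f j) i\<close>.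
\<close>

definition poly2 :: "real poly poly \<Rightarrow> real \<times> real \<Rightarrow> real" where
  "poly2 f z = poly (poly f [:snd z:]) (fst z)"

definition has_total_degree :: "real poly poly \<Rightarrow> nat \<Rightarrow> bool" where
  "has_total_degree f n \<longleftrightarrow>
     (\<exists>i j. coeff (coeff f j) i \<noteq> 0 \<and> i + j = n) \<and>
     (\<forall>i j. coeff (coeff f j) i \<noteq> 0 \<longrightarrow> i + j \<le> n)"

text \<open>The univariate polynomial \<open>t \<mapsto> f (z + t d)\<close>.\<close>

definition line_poly :: "real poly poly \<Rightarrow> real \<times> real \<Rightarrow> real \<times> real \<Rightarrow> real poly" where
  "line_poly f z d = poly (map_poly (\<lambda>q. pcompose q [:fst z, fst d:]) f) [:snd z, snd d:]"

lemma poly_line_poly: "poly (line_poly f z d) t = poly2 f (z + t *\<^sub>R d)"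
proof (induction f)
  case 0
  show ?case by (simp add: line_poly_def poly2_def)
next
  case (pCons a f)
  have "line_poly (pCons a f) z d =
      pcompose a [:fst z, fst d:] + [:snd z, snd d:] * line_poly f z d"
    by (simp add: line_poly_def map_poly_pCons pCons.hyps)
  with pCons.IH show ?case
    by (simp add: poly2_def poly_pcompose algebra_simps)
qed

text \<open>
  An affine coordinate system \<open>\<phi>\<close> on a plane \<open>range \<phi>\<close> that does not contain the origin. The
  Euclidean plane is itself such a plane, and a curve in it is measured by its own coordinates;
  central projection from it onto itself is the identity.
\<close>

definition projection_chart :: "geometry \<Rightarrow> (real \<times> real \<Rightarrow> real^3) \<Rightarrow> bool" where
  "projection_chart G \<phi> \<longleftrightarrow>
     (\<exists>a u v. \<forall>x y. \<phi> (x, y) = a + x *\<^sub>R u + y *\<^sub>R v) \<and>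
     inj \<phi> \<and> 0 \<notin> range \<phi> \<and>
     (G = Euclidean \<longrightarrow> range \<phi> = surface Euclidean)"

text \<open>
  A curve of the surface is represented by its central projection \<open>f = 0\<close> onto a plane. It is the
  polynomial that is kept, not just its real zero set, since multiplicities are needed.
\<close>

definition curve_of_degree ::
    "geometry \<Rightarrow> nat \<Rightarrow> (real \<times> real \<Rightarrow> real^3) \<Rightarrow> real poly poly \<Rightarrow> bool" where
  "curve_of_degree G n \<phi> f \<longleftrightarrow> projection_chart G \<phi> \<and> has_total_degree f n"

definition central_projection :: "(real^3) set \<Rightarrow> real^3 \<Rightarrow> real^3 \<Rightarrow> bool" where
  "central_projection w P Q \<longleftrightarrow> Q \<in> w \<and> Q \<in> span {P}"

text \<open>
  In the plane \<open>range \<phi>\<close>, the line \<open>L\<close> of the surface becomes \<open>range \<phi> \<inter> span L\<close>. The following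
  definitions compare it with the plane curve \<open>f = 0\<close>.
\<close>

definition contains_line :: "(real \<times> real \<Rightarrow> real^3) \<Rightarrow> real poly poly \<Rightarrow> (real^3) set \<Rightarrow> bool" where
  "contains_line \<phi> f L \<longleftrightarrow> (\<forall>z. \<phi> z \<in> span L \<longrightarrow> poly2 f z = 0)"

text \<open>
  Intersection multiplicity at the point with coordinates \<open>z\<close>, assumed to lie on the projected
  line; the direction \<open>d\<close> is determined up to a nonzero factor, which does not affect the order.
\<close>

definition intersection_mult ::
    "(real \<times> real \<Rightarrow> real^3) \<Rightarrow> real poly poly \<Rightarrow> (real^3) set \<Rightarrow> real \<times> real \<Rightarrow> nat" where
  "intersection_mult \<phi> f L z =
     order 0 (line_poly f z (SOME d. d \<noteq> 0 \<and> \<phi> (z + d) \<in> span L))"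

text \<open>
  The points \<open>P 1, \<dots>, P n\<close> of the line \<open>L\<close> lie on the curve of the surface whose central projection
  onto \<open>range \<phi>\<close> is \<open>f = 0\<close>. The curve must not contain \<open>L\<close> itself, and points with the same
  projection (repeated, or antipodal on the sphere) are counted with multiplicity; if the
  projections are distinct, the last condition follows from the one before it.
\<close>

definition lie_on_curve :: "(real \<times> real \<Rightarrow> real^3) \<Rightarrow> real poly poly \<Rightarrow> (real^3) set \<Rightarrow>
    nat \<Rightarrow> (nat \<Rightarrow> real^3) \<Rightarrow> bool" where
  "lie_on_curve \<phi> f L n P \<longleftrightarrow>
     \<not> contains_line \<phi> f L \<and>
     (\<exists>q. \<forall>k\<in>{1..n}.
        central_projection (range \<phi>) (P k) (\<phi> (q k)) \<and>
        poly2 f (q k) = 0 \<and>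
        card {j\<in>{1..n}. q j = q k} \<le> intersection_mult \<phi> f L (q k))"

end

theory Submission
  imports Defs
begin

text \<open>
  All three geometries reduce to one statement about forms on three-space. An oriented line
  parametrised by arc length is \<open>gcos t p + gsin t e\<close>, so the cross product of two of its points \<open>X\<close> and \<open>Y\<close>
  is \<open>gsin(XY)\<close> times a vector that depends only on the line (\<open>cross3_oriented_line\<close>). Therefore a point
  of the line through \<open>B\<close> and \<open>C\<close> is proportional to \<open>t B + C\<close>, where \<open>t = gsin(CX) / gsin(XB)\<close>
  (\<open>gsin_ratio\<close>), and the product in the theorem is the product of these parameters over all \<open>3n\<close>
  points.

  A curve \<open>f = 0\<close> of degree \<open>n\<close> in a plane that avoids the origin is the trace of a homogeneous
  function \<open>F\<close> of degree \<open>n\<close> on three-space. Points with parameters \<open>t\<^sub>1, \<dots>, t\<^sub>n\<close> on the line through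
  \<open>B\<close> and \<open>C\<close> lie on the curve, counted with multiplicity, exactly if \<open>F (y B + z C)\<close> is a nonzero
  constant times the product of the \<open>y - t\<^sub>k z\<close> (\<open>lie_on_curve_iff\<close>). In that case \<open>F C\<close> is \<open>F B\<close> times the
  product of the \<open>- t\<^sub>k\<close>. Going once around the triangle multiplies \<open>F B\<close> by the product of all \<open>3n\<close>
  negated parameters, which must therefore be \<open>1\<close>.

  Conversely, if this product is \<open>1\<close>, the three binary forms prescribed on the sides can be scaled to agree
  at the vertices, and they are then the restrictions of a single form of degree \<open>n\<close> on
  three-space (\<open>curve_exists\<close>).
\<close>

section \<open>Bases and planes in three-space\<close>

text \<open>
  Cramer's rule: when the three vectors are independent, the cofactors are the coordinates of
  \<open>X\<close>, and the cross products form, up to the determinant, the dual basis.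
\<close>

lemma cross3_basis_expansion:
  "(A \<bullet> cross3 B C) *\<^sub>R X =
     (X \<bullet> cross3 B C) *\<^sub>R A + (X \<bullet> cross3 C A) *\<^sub>R B + (X \<bullet> cross3 A B) *\<^sub>R C"
  unfolding vec_eq_iff forall_3
  by (simp add: cross3_def inner_vec_def sum_3, intro conjI; algebra)

lemma cross3_dual_basis_expansion:
  "(A \<bullet> cross3 B C) *\<^sub>R X =
     (X \<bullet> A) *\<^sub>R cross3 B C + (X \<bullet> B) *\<^sub>R cross3 C A + (X \<bullet> C) *\<^sub>R cross3 A B"
  unfolding vec_eq_iff forall_3
  by (simp add: cross3_def inner_vec_def sum_3, intro conjI; algebra)

text \<open>
  The coordinate along \<open>P\<close> in the plane spanned by \<open>P\<close> and \<open>E\<close>. This formula makes it a linear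
  function of \<open>X\<close>, so that it can be differentiated along a curve; the coordinate along \<open>E\<close> is
  \<open>plane_coord E P X\<close>.
\<close>

definition plane_coord :: "real^3 \<Rightarrow> real^3 \<Rightarrow> real^3 \<Rightarrow> real" where
  "plane_coord P E X = cross3 X E \<bullet> cross3 P E / (cross3 P E \<bullet> cross3 P E)"

text \<open>
  A vector orthogonal to \<open>N\<close> has no component along \<open>cross3 P E\<close>: otherwise it would form a basis
  together with \<open>P\<close> and \<open>E\<close>, and \<open>N\<close>, orthogonal to that basis, would vanish.
\<close>

lemma plane_coord_expansion:
  assumes N: "N \<noteq> 0" and P: "N \<bullet> P = 0" and E: "N \<bullet> E = 0" and X: "N \<bullet> X = 0"
    and indep: "cross3 P E \<noteq> 0"
  shows "X = plane_coord P E X *\<^sub>R P + plane_coord E P X *\<^sub>R E"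
proof -
  let ?c = "cross3 P E"
  have "(X \<bullet> ?c) *\<^sub>R N = 0"
    using cross3_dual_basis_expansion[of X P E N] P E X by simp
  then have Xc: "X \<bullet> ?c = 0" using N by simp
  have "(?c \<bullet> ?c) *\<^sub>R X = (X \<bullet> cross3 E ?c) *\<^sub>R P + (X \<bullet> cross3 ?c P) *\<^sub>R E"
    using cross3_basis_expansion[of ?c P E X] Xc by simp
  moreover have "X \<bullet> cross3 E ?c = cross3 X E \<bullet> ?c" "X \<bullet> cross3 ?c P = cross3 X P \<bullet> cross3 E P"
    by (simp_all add: cross3_def inner_vec_def sum_3 algebra_simps)
  ultimately have "(?c \<bullet> ?c) *\<^sub>R X
      = (cross3 X E \<bullet> ?c) *\<^sub>R P + (cross3 X P \<bullet> cross3 E P) *\<^sub>R E" by simp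
  moreover have cc: "?c \<bullet> ?c \<noteq> 0" using indep by simp
  moreover have "cross3 E P \<bullet> cross3 E P = ?c \<bullet> ?c" by (simp add: cross_skew[of E P])
  ultimately have "(?c \<bullet> ?c) *\<^sub>R X = (?c \<bullet> ?c) *\<^sub>R
       (plane_coord P E X *\<^sub>R P + plane_coord E P X *\<^sub>R E)"
    by (simp add: plane_coord_def scaleR_add_right)
  then show ?thesis using cc by (metis scaleR_cancel_left)
qed

lemma plane_coord_combination:
  assumes "cross3 P E \<noteq> 0"
  shows "plane_coord P E (x *\<^sub>R P + y *\<^sub>R E) = x" "plane_coord E P (x *\<^sub>R P + y *\<^sub>R E) = y"
proof -
  have "cross3 E P \<noteq> 0" using assms by (metis cross_skew neg_0_equal_iff_equal)
  with assms show "plane_coord P E (x *\<^sub>R P + y *\<^sub>R E) = x" "plane_coord E P (x *\<^sub>R P + y *\<^sub>R E) = y"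
    by (simp_all add: plane_coord_def cross_add_left cross_mult_left)
qed

lemma bounded_linear_plane_coord: "bounded_linear (plane_coord P E)"
proof -
  have "linear (plane_coord P E)"
    by (rule linearI)
      (simp_all add: plane_coord_def cross_add_left cross_mult_left inner_add_left add_divide_distrib)
  then show ?thesis by (rule linear_conv_bounded_linear[THEN iffD1])
qed

section \<open>Generalised sines as cross products\<close>

primrec gcos :: "geometry \<Rightarrow> real \<Rightarrow> real" where
  "gcos Spherical = cos"
| "gcos Euclidean = (\<lambda>t. 1)"
| "gcos Hyperbolic = cosh"

lemma gsin_gcos:
  shows DERIV_gsin: "(gsin (curvature G) has_real_derivative gcos G t) (at t)"
    and DERIV_gcos: "(gcos G has_real_derivative - curvature G * gsin (curvature G) t) (at t)"
    and gcos_gsin_squares: "(gcos G t)\<^sup>2 + curvature G * (gsin (curvature G) t)\<^sup>2 = 1"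
    and gcos_0: "gcos G 0 = 1"
    and gsin_0: "gsin (curvature G) 0 = 0"
    and gsin_diff: "gcos G s * gsin (curvature G) t - gsin (curvature G) s * gcos G t
           = gsin (curvature G) (t - s)"
proof -
  have euc: "gsin (curvature Euclidean) = (\<lambda>x. x)" by (rule ext) (rule gsin_euclidean)
  note f = gsin_spherical euc gsin_hyperbolic
  show "(gsin (curvature G) has_real_derivative gcos G t) (at t)"
    by (cases G) (auto simp only: f gcos.simps intro!: derivative_eq_intros)
  show "(gcos G has_real_derivative - curvature G * gsin (curvature G) t) (at t)"
    by (cases G) (simp_all only: f gcos.simps, auto intro!: derivative_eq_intros)
  show "(gcos G t)\<^sup>2 + curvature G * (gsin (curvature G) t)\<^sup>2 = 1"
    by (cases G) (simp_all only: f gcos.simps, simp_all add: cosh_square_eq)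
  show "gcos G 0 = 1" by (cases G) simp_all
  show "gsin (curvature G) 0 = 0" by (cases G) (simp_all only: f, simp_all)
  show "gcos G s * gsin (curvature G) t - gsin (curvature G) s * gcos G t
           = gsin (curvature G) (t - s)"
    by (cases G) (simp_all only: f gcos.simps, simp_all add: sin_diff sinh_diff mult.commute)
qed

text \<open>
  The two constraints say that the point \<open>(x, y)\<close> moves on a conic (circle, line or hyperbola) at
  unit speed. They force the Wronskian \<open>x y' - y x'\<close> to be \<open>1\<close> or \<open>- 1\<close>; it is continuous, so it
  keeps its initial value \<open>1\<close>. Together with the tangency condition this determines \<open>x'\<close> and \<open>y'\<close>
  as linear functions of \<open>x\<close> and \<open>y\<close>.
\<close>

lemma unit_speed_conic_ode:
  fixes K :: real
  assumes K: "K = 1 \<or> K = 0 \<or> K = - 1"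
    and x: "\<And>t. (x has_real_derivative x' t) (at t)"
    and y: "\<And>t. (y has_real_derivative y' t) (at t)"
    and cont: "continuous_on UNIV x'" "continuous_on UNIV y'"
    and conic: "\<And>t. (x t)\<^sup>2 + K * (y t)\<^sup>2 = 1"
    and speed: "\<And>t. K * (x' t)\<^sup>2 + (y' t)\<^sup>2 = 1"
    and init: "x 0 = 1" "y 0 = 0" "y' 0 = 1"
  shows "x' t = - K * y t" "y' t = x t"
proof -
  have tangent: "x t * x' t + K * y t * y' t = 0" for t
  proof -
    have "((\<lambda>t. (x t)\<^sup>2 + K * (y t)\<^sup>2) has_real_derivative
        2 * (x t * x' t + K * y t * y' t)) (at t)"
      by (rule derivative_eq_intros x y | simp add: algebra_simps)+
    moreover have "((\<lambda>t. (x t)\<^sup>2 + K * (y t)\<^sup>2) has_real_derivative 0) (at t)"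
      by (simp add: conic)
    ultimately show ?thesis using DERIV_unique by fastforce
  qed
  define w where "w t = x t * y' t - y t * x' t" for t
  have w2: "(w t)\<^sup>2 = 1" for t
  proof (cases "K = 0")
    case True
    then have "(x t)\<^sup>2 = 1" "x' t = 0" "(y' t)\<^sup>2 = 1"
      using conic[of t] tangent[of t] speed[of t] by auto
    then show ?thesis by (simp add: w_def power_mult_distrib)
  next
    case False
    then have KK: "K * K = 1" using K by auto
    \<comment> \<open>A variant of Lagrange's identity, valid since \<open>K\<^sup>2 = 1\<close>.\<close>
    have "(w t)\<^sup>2 = ((x t)\<^sup>2 + K * (y t)\<^sup>2) * (K * (x' t)\<^sup>2 + (y' t)\<^sup>2)
        - K * (x t * x' t + K * y t * y' t)\<^sup>2"
      using KK unfolding w_def by algebra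
    then show ?thesis by (simp add: conic speed tangent)
  qed
  have contw: "continuous_on UNIV w"
    unfolding w_def
    by (intro continuous_intros cont DERIV_continuous_on[of _ x x'] DERIV_continuous_on[of _ y y'] x y)
  have w1: "w t = 1" for t
  proof (rule ccontr)
    assume "w t \<noteq> 1"
    then have "w t = - 1" using w2[of t] by (simp add: power2_eq_1_iff)
    moreover have "w 0 = 1" by (simp add: w_def init)
    moreover have "connected (range w)" using contw by (simp add: connected_continuous_image)
    ultimately have "0 \<in> range w"
      using connectedD_interval[of "range w" "w t" "w 0" 0] rangeI[of w t] rangeI[of w 0] by simp
    then show False using w2 by (metis imageE power_zero_numeral zero_neq_one)
  qed
  have "x' t = x t * (x t * x' t + K * y t * y' t) - K * y t * w t"
    using conic[of t] unfolding w_def by algebra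
  then show "x' t = - K * y t" by (simp add: tangent w1)
  have "y' t = y t * (x t * x' t + K * y t * y' t) + x t * w t"
    using conic[of t] unfolding w_def by algebra
  then show "y' t = x t" by (simp add: tangent w1)
qed

text \<open>
  Uniqueness of the solution without any theory of differential equations: two bilinear
  expressions in the given and the expected solution have derivative zero, and their constant values
  give a linear system with determinant \<open>1\<close>.
\<close>

lemma gcos_gsin_unique:
  assumes x: "\<And>t. (x has_real_derivative - curvature G * y t) (at t)"
    and y: "\<And>t. (y has_real_derivative x t) (at t)"
    and init: "x 0 = 1" "y 0 = 0"
  shows "x t = gcos G t" "y t = gsin (curvature G) t"
proof -
  let ?K = "curvature G" and ?C = "gcos G" and ?S = "gsin (curvature G)"
  have const: "f t = f 0" if "\<And>s. (f has_real_derivative 0) (at s)" for f :: "real \<Rightarrow> real"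
    using that DERIV_isconst_all by blast
  note d = x y DERIV_gsin DERIV_gcos
  have "((\<lambda>t. y t * ?C t - x t * ?S t) has_real_derivative 0) (at s)" for s
    by (auto intro!: derivative_eq_intros d simp: algebra_simps)
  then have 1: "y t * ?C t - x t * ?S t = 0"
    using const[of "\<lambda>t. y t * ?C t - x t * ?S t"] by (simp add: init gsin_0)
  have "((\<lambda>t. x t * ?C t + ?K * (y t * ?S t)) has_real_derivative 0) (at s)" for s
    by (auto intro!: derivative_eq_intros d simp: algebra_simps)
  then have 2: "x t * ?C t + ?K * (y t * ?S t) = 1"
    using const[of "\<lambda>t. x t * ?C t + ?K * (y t * ?S t)"] by (simp add: init gcos_0)
  show "x t = gcos G t" "y t = gsin (curvature G) t"
    using 1 2 gcos_gsin_squares[of G t] by algebra+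
qed

lemma metric_bilinear_square:
  "metric G (x *\<^sub>R p + y *\<^sub>R e) (x *\<^sub>R p + y *\<^sub>R e)
     = x\<^sup>2 * metric G p p + 2 * x * y * metric G p e + y\<^sup>2 * metric G e e"
  by (cases G) (simp_all add: inner_vec_def sum_3 algebra_simps power2_eq_square)

text \<open>
  The equation of the surface is differentiated along the curve. In the Euclidean case it is linear and
  constrains only the height.
\<close>

lemma surface_tangent:
  assumes \<gamma>: "\<And>t. \<gamma> t \<in> surface G"
    and \<gamma>': "(\<gamma> has_vector_derivative e) (at t)"
  shows "if G = Euclidean then e $ 3 = 0 else metric G (\<gamma> t) e = 0"
proof -
  have d: "((\<lambda>t. \<gamma> t $ i) has_real_derivative e $ i) (at t)" for i
    using bounded_linear.has_vector_derivative[OF bounded_linear_vec_nth \<gamma>']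
    by (simp add: has_real_derivative_iff_has_vector_derivative)
  show ?thesis
  proof (cases G)
    case Spherical
    have "((\<lambda>t. (\<gamma> t $ 1)^2 + (\<gamma> t $ 2)^2 + (\<gamma> t $ 3)^2) has_real_derivative
        2 * (\<gamma> t $ 1 * e $ 1 + \<gamma> t $ 2 * e $ 2 + \<gamma> t $ 3 * e $ 3)) (at t)"
      by (rule derivative_eq_intros d | simp add: algebra_simps)+
    moreover have "((\<lambda>t. (\<gamma> t $ 1)^2 + (\<gamma> t $ 2)^2 + (\<gamma> t $ 3)^2) has_real_derivative 0) (at t)"
      using \<gamma> Spherical by simp
    ultimately have "2 * (\<gamma> t $ 1 * e $ 1 + \<gamma> t $ 2 * e $ 2 + \<gamma> t $ 3 * e $ 3) = 0"
      by (rule DERIV_unique)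
    then show ?thesis using Spherical by (simp add: inner_vec_def sum_3)
  next
    case Euclidean
    have "((\<lambda>t. \<gamma> t $ 3) has_real_derivative 0) (at t)" using \<gamma> Euclidean by simp
    with d[of 3] have "e $ 3 = 0" by (rule DERIV_unique)
    then show ?thesis using Euclidean by simp
  next
    case Hyperbolic
    have "((\<lambda>t. (\<gamma> t $ 1)^2 + (\<gamma> t $ 2)^2 - (\<gamma> t $ 3)^2) has_real_derivative
        2 * (\<gamma> t $ 1 * e $ 1 + \<gamma> t $ 2 * e $ 2 - \<gamma> t $ 3 * e $ 3)) (at t)"
      by (rule derivative_eq_intros d | simp add: algebra_simps)+
    moreover have "((\<lambda>t. (\<gamma> t $ 1)^2 + (\<gamma> t $ 2)^2 - (\<gamma> t $ 3)^2) has_real_derivative 0) (at t)"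
      using \<gamma> Hyperbolic by simp
    ultimately have "2 * (\<gamma> t $ 1 * e $ 1 + \<gamma> t $ 2 * e $ 2 - \<gamma> t $ 3 * e $ 3) = 0"
      by (rule DERIV_unique)
    then show ?thesis using Hyperbolic by simp
  qed
qed

text \<open>
  By Lagrange's identity the Gram determinant of \<open>p\<close> and \<open>e\<close> is a quadratic form in the entries
  of their cross product, but here it is \<open>1\<close> on the sphere and \<open>- 1\<close> on the hyperboloid. In the
  Euclidean plane \<open>p\<close> has height \<open>1\<close> and \<open>e\<close> has height \<open>0\<close>.
\<close>

lemma unit_tangent_independent:
  assumes p: "p \<in> surface G" and e: "metric G e e = 1"
    and tangent: "if G = Euclidean then e $ 3 = 0 else metric G p e = 0"
  shows "cross3 p e \<noteq> 0"
proof
  assume *: "cross3 p e = 0"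
  then have c: "p $ 2 * e $ 3 = p $ 3 * e $ 2" "p $ 3 * e $ 1 = p $ 1 * e $ 3" "p $ 1 * e $ 2 = p $ 2 * e $ 1"
    by (simp_all add: cross3_def vec_eq_iff forall_3)
  show False
  proof (cases G)
    case Spherical
    then have "(p $ 1)^2 + (p $ 2)^2 + (p $ 3)^2 = 1" "(e $ 1)^2 + (e $ 2)^2 + (e $ 3)^2 = 1"
      "p $ 1 * e $ 1 + p $ 2 * e $ 2 + p $ 3 * e $ 3 = 0"
      using p e tangent by (simp_all add: inner_vec_def sum_3 power2_eq_square)
    with c show False by algebra
  next
    case Euclidean
    then have "p $ 3 = 1" "(e $ 1)^2 + (e $ 2)^2 + (e $ 3)^2 = 1" "e $ 3 = 0"
      using p e tangent by (simp_all add: inner_vec_def sum_3 power2_eq_square)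
    with c show False by algebra
  next
    case Hyperbolic
    then have "(p $ 1)^2 + (p $ 2)^2 - (p $ 3)^2 = -1" "(e $ 1)^2 + (e $ 2)^2 - (e $ 3)^2 = 1"
      "p $ 1 * e $ 1 + p $ 2 * e $ 2 - p $ 3 * e $ 3 = 0"
      using p e tangent by (simp_all add: power2_eq_square)
    with c show False by algebra
  qed
qed

lemma surface_metric:
  assumes "G \<noteq> Euclidean" "p \<in> surface G"
  shows "metric G p p = curvature G"
  using assms by (cases G) (simp_all add: inner_vec_def sum_3 power2_eq_square)

text \<open>
  An oriented line is only known to be traversed at unit speed; that it is
  traversed in the standard way is what relates signed distances to the surrounding space. The initial
  point and the initial velocity serve as a basis of the plane that contains the line, and the
  coordinates with respect to it satisfy the equations of the previous lemmas.
\<close>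

lemma oriented_line_parametrisation:
  assumes "oriented_line G \<gamma>"
  obtains p e where "\<And>t. \<gamma> t = gcos G t *\<^sub>R p + gsin (curvature G) t *\<^sub>R e"
proof -
  let ?K = "curvature G"
  from assms obtain N \<gamma>' where N: "N \<noteq> 0" "range \<gamma> = surface G \<inter> {X. N \<bullet> X = 0}"
    and cont: "continuous_on UNIV \<gamma>'"
    and \<gamma>': "\<And>t. (\<gamma> has_vector_derivative \<gamma>' t) (at t)"
    and unit: "\<And>t. metric G (\<gamma>' t) (\<gamma>' t) = 1"
    unfolding oriented_line_def is_line_def by blast
  have surf: "\<gamma> t \<in> surface G" and N\<gamma>: "N \<bullet> \<gamma> t = 0" for t
    using N(2) rangeI[of \<gamma> t] by auto
  have N\<gamma>': "N \<bullet> \<gamma>' t = 0" for t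
  proof -
    have "((\<lambda>t. N \<bullet> \<gamma> t) has_vector_derivative N \<bullet> \<gamma>' t) (at t)"
      using bounded_linear.has_vector_derivative[OF bounded_linear_inner_right \<gamma>'] .
    moreover have "((\<lambda>t. N \<bullet> \<gamma> t) has_vector_derivative 0) (at t)" by (simp add: N\<gamma>)
    ultimately show ?thesis by (rule vector_derivative_unique_at)
  qed
  define p e where "p = \<gamma> 0" and "e = \<gamma>' 0"
  have tangent: "if G = Euclidean then e $ 3 = 0 else metric G p e = 0"
    unfolding p_def e_def using surface_tangent[OF surf \<gamma>'] .
  have p: "p \<in> surface G" and e: "metric G e e = 1" by (simp_all add: p_def e_def surf unit)
  have indep: "cross3 p e \<noteq> 0" using unit_tangent_independent[OF p e tangent] .
  define x y x' y' where "x t = plane_coord p e (\<gamma> t)" and "y t = plane_coord e p (\<gamma> t)"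
    and "x' t = plane_coord p e (\<gamma>' t)" and "y' t = plane_coord e p (\<gamma>' t)" for t
  have \<gamma>_eq: "\<gamma> t = x t *\<^sub>R p + y t *\<^sub>R e" for t
    unfolding x_def y_def
    by (rule plane_coord_expansion[OF N(1)]) (simp_all add: p_def e_def N\<gamma> N\<gamma>' indep[unfolded p_def e_def])
  have \<gamma>'_eq: "\<gamma>' t = x' t *\<^sub>R p + y' t *\<^sub>R e" for t
    unfolding x'_def y'_def
    by (rule plane_coord_expansion[OF N(1)]) (simp_all add: p_def e_def N\<gamma> N\<gamma>' indep[unfolded p_def e_def])
  have dx: "(x has_real_derivative x' t) (at t)" and dy: "(y has_real_derivative y' t) (at t)" for t
    unfolding x_def y_def x'_def y'_def has_real_derivative_iff_has_vector_derivative
    by (rule bounded_linear.has_vector_derivative[OF bounded_linear_plane_coord \<gamma>'])+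
  have cont': "continuous_on UNIV x'" "continuous_on UNIV y'"
    unfolding x'_def y'_def
    by (rule bounded_linear.continuous_on[OF bounded_linear_plane_coord cont])+
  have x1: "x t = 1" if "G = Euclidean" for t
  proof -
    have "\<gamma> t $ 3 = 1" "p $ 3 = 1" "e $ 3 = 0" using surf[of t] p tangent that by simp_all
    then show ?thesis using \<gamma>_eq[of t] by simp
  qed
  have conic: "(x t)\<^sup>2 + ?K * (y t)\<^sup>2 = 1" for t
  proof (cases "G = Euclidean")
    case True
    then show ?thesis by (simp add: x1)
  next
    case False
    have "?K = metric G (\<gamma> t) (\<gamma> t)" using surface_metric[OF False surf] by simp
    also have "\<dots> = (x t)\<^sup>2 * ?K + (y t)\<^sup>2"
      unfolding \<gamma>_eq[of t] metric_bilinear_square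
      using False tangent e surface_metric[OF False p] by simp
    finally show ?thesis using False by (cases G) (simp_all add: algebra_simps)
  qed
  have speed: "?K * (x' t)\<^sup>2 + (y' t)\<^sup>2 = 1" for t
  proof (cases "G = Euclidean")
    case True
    have "x = (\<lambda>t. 1)" using x1[OF True] by auto
    then have "(x has_real_derivative 0) (at t)" by simp
    then have "x' t = 0" using dx[of t] DERIV_unique by blast
    then show ?thesis using unit[of t] e True unfolding \<gamma>'_eq[of t] metric_bilinear_square by simp
  next
    case False
    then show ?thesis
      using unit[of t] tangent e surface_metric[OF False p]
      unfolding \<gamma>'_eq[of t] metric_bilinear_square by (simp add: mult.commute)
  qed
  have "x 0 = 1" "y 0 = 0" "y' 0 = 1"
    using plane_coord_combination[OF indep, of 1 0] plane_coord_combination(2)[OF indep, of 0 1]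
    by (simp_all add: x_def y_def y'_def p_def e_def)
  moreover have "?K = 1 \<or> ?K = 0 \<or> ?K = - 1" by (cases G) simp_all
  ultimately have "x' t = - ?K * y t" "y' t = x t" for t
    using unit_speed_conic_ode[OF _ dx dy cont' conic speed] by blast+
  with dx dy have "(x has_real_derivative - ?K * y t) (at t)" "(y has_real_derivative x t) (at t)" for t
    by metis+
  then have "x t = gcos G t" "y t = gsin ?K t" for t
    using gcos_gsin_unique \<open>x 0 = 1\<close> \<open>y 0 = 0\<close> by blast+
  with \<gamma>_eq have "\<gamma> t = gcos G t *\<^sub>R p + gsin ?K t *\<^sub>R e" for t by metis
  then show thesis by (rule that)
qed

text \<open>
  The addition formula for the generalised sine is the reason: the area of the parallelogram
  spanned by two points of the line depends only on the difference of their parameters. In particular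
  it does not matter which of the possible signed distances is chosen on the sphere.
\<close>

lemma cross3_oriented_line:
  assumes "oriented_line G \<gamma>"
  obtains M where
    "\<And>X Y. X \<in> range \<gamma> \<Longrightarrow> Y \<in> range \<gamma> \<Longrightarrow> cross3 X Y = gsin_along G \<gamma> X Y *\<^sub>R M"
proof -
  obtain p e where \<gamma>: "\<And>t. \<gamma> t = gcos G t *\<^sub>R p + gsin (curvature G) t *\<^sub>R e"
    using oriented_line_parametrisation[OF assms] by metis
  have "cross3 (\<gamma> s) (\<gamma> t) = gsin (curvature G) (t - s) *\<^sub>R cross3 p e" for s t
    unfolding gsin_diff[symmetric] \<gamma>
    by (simp add: cross_add_left cross_add_right cross_mult_left cross_mult_right
        cross_skew[of e p] algebra_simps)
  then have *: "cross3 (\<gamma> s) (\<gamma> (s + d)) = gsin (curvature G) d *\<^sub>R cross3 p e" for s d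
    by (metis add_diff_cancel_left')
  show thesis
  proof (rule that)
    fix X Y assume "X \<in> range \<gamma>" "Y \<in> range \<gamma>"
    then obtain s t where "X = \<gamma> s" "Y = \<gamma> (s + (t - s))" by auto
    then have "\<exists>d s. \<gamma> s = X \<and> \<gamma> (s + d) = Y" by metis
    then have "\<exists>s. \<gamma> s = X \<and> \<gamma> (s + signed_dist \<gamma> X Y) = Y"
      unfolding signed_dist_def by (rule someI_ex)
    then show "cross3 X Y = gsin_along G \<gamma> X Y *\<^sub>R cross3 p e"
      using * unfolding gsin_along_def by metis
  qed
qed

lemma oriented_line_plane:
  assumes "oriented_line G \<gamma>" and "{B, C} \<subseteq> range \<gamma>" and indep: "cross3 B C \<noteq> 0"
  shows "span (range \<gamma>) = span {B, C}"
proof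
  have "is_line G (range \<gamma>)" using assms(1) by (simp add: oriented_line_def)
  then obtain N where N: "N \<noteq> 0" "range \<gamma> = surface G \<inter> {X. N \<bullet> X = 0}"
    unfolding is_line_def by metis
  have "X \<in> span {B, C}" if "X \<in> range \<gamma>" for X
  proof -
    have "N \<bullet> B = 0" "N \<bullet> C = 0" "N \<bullet> X = 0" using N(2) that assms(2) by auto
    then have "X = plane_coord B C X *\<^sub>R B + plane_coord C B X *\<^sub>R C"
      using plane_coord_expansion N(1) indep by blast
    then show ?thesis by (metis insertI1 insertI2 span_add span_base span_scale)
  qed
  then show "span (range \<gamma>) \<subseteq> span {B, C}" by (intro span_minimal) auto
  show "span {B, C} \<subseteq> span (range \<gamma>)" using assms(2) by (rule span_mono)
qed

lemma in_span_pair: "X \<in> span {B, C} \<longleftrightarrow> (\<exists>y z. X = y *\<^sub>R B + z *\<^sub>R C)"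
  for X :: "'a::real_vector"
proof -
  have "X \<in> span {B, C} \<longleftrightarrow> (\<exists>y z. X - y *\<^sub>R B = z *\<^sub>R C)"
    by (auto simp: span_insert[of B] span_singleton)
  then show ?thesis by (simp add: diff_eq_eq add.commute)
qed

text \<open>
  The quotients in the theorem are projective coordinates: the cross products of \<open>X\<close> with \<open>C\<close>
  and with \<open>B\<close> pick out its coefficients with respect to \<open>B\<close> and \<open>C\<close>.
\<close>

lemma gsin_ratio:
  assumes "oriented_line G \<gamma>" and BC: "{B, C} \<subseteq> range \<gamma>" and X: "X \<in> range \<gamma>"
    and indep: "cross3 B C \<noteq> 0" and "gsin_along G \<gamma> X B \<noteq> 0"
  obtains \<mu> where "\<mu> \<noteq> 0"
    and "X = \<mu> *\<^sub>R ((gsin_along G \<gamma> C X / gsin_along G \<gamma> X B) *\<^sub>R B + C)"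
proof -
  obtain M where M: "\<And>X Y. X \<in> range \<gamma> \<Longrightarrow> Y \<in> range \<gamma> \<Longrightarrow> cross3 X Y = gsin_along G \<gamma> X Y *\<^sub>R M"
    using cross3_oriented_line[OF assms(1)] by blast
  have M0: "M \<noteq> 0" using M[of B C] BC indep by auto
  have "X \<in> span {B, C}"
    using span_base[OF X] oriented_line_plane[OF assms(1) BC indep] by simp
  then obtain \<kappa> \<mu> where X_eq: "X = \<kappa> *\<^sub>R B + \<mu> *\<^sub>R C" by (auto simp: in_span_pair)
  have "gsin_along G \<gamma> C B *\<^sub>R M = cross3 C B" using M[of C B] BC by auto
  then have CX: "gsin_along G \<gamma> C X *\<^sub>R M = (\<kappa> * gsin_along G \<gamma> C B) *\<^sub>R M"
    and XB: "gsin_along G \<gamma> X B *\<^sub>R M = (\<mu> * gsin_along G \<gamma> C B) *\<^sub>R M"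
    using M[of C X] M[of X B] BC X
    by (simp_all add: X_eq cross_add_left cross_add_right cross_mult_left cross_mult_right
        flip: scaleR_scaleR)
  then have "gsin_along G \<gamma> C X = \<kappa> * gsin_along G \<gamma> C B" "gsin_along G \<gamma> X B = \<mu> * gsin_along G \<gamma> C B"
    using M0 by simp_all
  with assms(5) have \<mu>: "\<mu> \<noteq> 0" and ratio: "gsin_along G \<gamma> C X / gsin_along G \<gamma> X B = \<kappa> / \<mu>"
    by auto
  have "X = \<mu> *\<^sub>R ((\<kappa> / \<mu>) *\<^sub>R B + C)" using X_eq \<mu> by (simp add: scaleR_add_right)
  then show thesis using that[OF \<mu>] unfolding ratio by blast
qed

text \<open>
  A vector orthogonal to all three vertices would be the normal of a plane that cuts out a line
  containing them.
\<close>

lemma triangle_det: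
  assumes "is_triangle G A B C"
  shows "A \<bullet> cross3 B C \<noteq> 0"
proof -
  let ?M = "vector [A, B, C] :: real^3^3"
  have "N = 0" if "?M *v N = 0" for N
  proof (rule ccontr)
    assume "N \<noteq> 0"
    have "?M $ i \<bullet> N = 0" for i
      using arg_cong[OF that, of "\<lambda>v. v $ i"] by (simp add: matrix_vector_mul_component)
    from this[of 1] this[of 2] this[of 3] have "A \<bullet> N = 0" "B \<bullet> N = 0" "C \<bullet> N = 0"
      by simp_all
    then have "{A, B, C} \<subseteq> surface G \<inter> {X. N \<bullet> X = 0}"
      using assms by (auto simp: is_triangle_def inner_commute)
    moreover from this have "is_line G (surface G \<inter> {X. N \<bullet> X = 0})"
      using \<open>N \<noteq> 0\<close> unfolding is_line_def by blast
    ultimately show False using assms unfolding is_triangle_def by blast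
  qed
  then have "invertible ?M"
    by (simp add: invertible_left_inverse matrix_left_invertible_ker)
  then show ?thesis by (simp add: dot_cross_det invertible_det_nz)
qed

section \<open>Bivariate polynomials of bounded total degree\<close>

text \<open>
  Unlike exact total degree, this bound is stable under addition, and products need no argument
  about leading terms.
\<close>

definition total_degree_le :: "real poly poly \<Rightarrow> nat \<Rightarrow> bool" where
  "total_degree_le f n \<longleftrightarrow> (\<forall>i j. coeff (coeff f j) i \<noteq> 0 \<longrightarrow> i + j \<le> n)"

lemma total_degree_le_add:
  assumes "total_degree_le f n" "total_degree_le g n"
  shows "total_degree_le (f + g) n"
  unfolding total_degree_le_def
proof (intro allI impI)
  fix i j assume "coeff (coeff (f + g) j) i \<noteq> 0"
  then have "coeff (coeff f j) i \<noteq> 0 \<or> coeff (coeff g j) i \<noteq> 0" by auto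
  with assms show "i + j \<le> n" unfolding total_degree_le_def by blast
qed

lemma total_degree_le_mult:
  assumes "total_degree_le f m" "total_degree_le g n"
  shows "total_degree_le (f * g) (m + n)"
  unfolding total_degree_le_def
proof (intro allI impI)
  fix i j assume "coeff (coeff (f * g) j) i \<noteq> 0"
  then have "(\<Sum>k\<le>j. \<Sum>l\<le>i. coeff (coeff f k) l * coeff (coeff g (j - k)) (i - l)) \<noteq> 0"
    by (simp add: coeff_mult coeff_sum)
  then obtain k where k: "k \<le> j"
    and "(\<Sum>l\<le>i. coeff (coeff f k) l * coeff (coeff g (j - k)) (i - l)) \<noteq> 0"
    by (metis (no_types, lifting) sum.neutral atMost_iff)
  then obtain l where l: "l \<le> i"
    and "coeff (coeff f k) l * coeff (coeff g (j - k)) (i - l) \<noteq> 0"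
    by (metis (no_types, lifting) sum.neutral atMost_iff)
  then have "coeff (coeff f k) l \<noteq> 0" "coeff (coeff g (j - k)) (i - l) \<noteq> 0" by auto
  then have "l + k \<le> m" "(i - l) + (j - k) \<le> n"
    using assms unfolding total_degree_le_def by blast+
  with k l show "i + j \<le> m + n" by linarith
qed

lemma poly_eq_sum_upto:
  fixes p :: "'a::comm_ring_1 poly"
  shows "degree p \<le> n \<Longrightarrow> poly p x = (\<Sum>i\<le>n. coeff p i * x ^ i)"
  using arg_cong[OF poly_as_sum_of_monoms'[of p n], of "\<lambda>p. poly p x"]
  by (simp add: poly_sum poly_monom)

lemma poly2_eq_sum:
  assumes "total_degree_le f n"
  shows "poly2 f (x, y) = (\<Sum>j\<le>n. \<Sum>i\<le>n. coeff (coeff f j) i * (x ^ i * y ^ j))"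
proof -
  have j: "coeff f j = 0" if "j > n" for j
    using assms that unfolding total_degree_le_def by (intro poly_eqI) fastforce
  have i: "degree (coeff f j) \<le> n" for j
    using assms unfolding total_degree_le_def by (intro degree_le) fastforce
  have "degree f \<le> n" using j by (intro degree_le) blast
  then have "poly2 f (x, y) = poly (\<Sum>j\<le>n. coeff f j * [:y:] ^ j) x"
    unfolding poly2_def by (simp add: poly_eq_sum_upto)
  also have "\<dots> = (\<Sum>j\<le>n. poly (coeff f j) x * y ^ j)" by (simp add: poly_sum)
  also have "\<dots> = (\<Sum>j\<le>n. \<Sum>i\<le>n. coeff (coeff f j) i * (x ^ i * y ^ j))"
    by (simp add: poly_eq_sum_upto[OF i] sum_distrib_right mult.assoc)
  finally show ?thesis .
qed

lemma poly2_arith: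
  "poly2 (f + g) z = poly2 f z + poly2 g z"
  "poly2 (f * g) z = poly2 f z * poly2 g z"
  "poly2 [:[:c:]:] z = c"
  by (simp_all add: poly2_def)

section \<open>Homogeneous extension of a plane curve\<close>

text \<open>
  Injectivity makes \<open>u\<close> and \<open>v\<close> independent, and \<open>a\<close> is independent of them since the plane
  avoids the origin.
\<close>

lemma projection_chart_frame:
  assumes "projection_chart G \<phi>"
  obtains a u v where "\<And>x y. \<phi> (x, y) = a + x *\<^sub>R u + y *\<^sub>R v" and "a \<bullet> cross3 u v \<noteq> 0"
proof -
  from assms obtain a u v where \<phi>: "\<And>x y. \<phi> (x, y) = a + x *\<^sub>R u + y *\<^sub>R v"
    and inj: "inj \<phi>" and zero: "0 \<notin> range \<phi>"
    unfolding projection_chart_def by blast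
  have indep: "w = 0 \<and> x = 0 \<and> y = 0" if "w *\<^sub>R a + x *\<^sub>R u + y *\<^sub>R v = 0" for w x y
  proof -
    have "w = 0"
    proof (rule ccontr)
      assume "w \<noteq> 0"
      then have "\<phi> (x / w, y / w) = (1 / w) *\<^sub>R (w *\<^sub>R a + x *\<^sub>R u + y *\<^sub>R v)"
        by (simp add: \<phi> algebra_simps)
      then have "\<phi> (x / w, y / w) = 0" using that by simp
      then show False using zero by (metis rangeI)
    qed
    then have "\<phi> (x, y) = \<phi> (0, 0)" using that by (simp add: \<phi> add.assoc)
    then show ?thesis using inj \<open>w = 0\<close> by (simp add: inj_eq)
  qed
  have "a \<bullet> cross3 u v \<noteq> 0"
  proof
    assume "a \<bullet> cross3 u v = 0"
    then have "(X \<bullet> cross3 u v) *\<^sub>R a + (X \<bullet> cross3 v a) *\<^sub>R u + (X \<bullet> cross3 a u) *\<^sub>R v = 0" for X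
      using cross3_basis_expansion[of a u v X] by simp
    then have "X \<bullet> cross3 a u = 0" for X using indep by blast
    then have "cross3 a u = 0" by (metis inner_eq_zero_iff)
    then have "(u \<bullet> u) *\<^sub>R a + (- (u \<bullet> a)) *\<^sub>R u + 0 *\<^sub>R v = 0"
      using Lagrange[of u a u] by simp
    from indep[OF this] have "u = 0" by simp
    then show False using indep[of 0 1 0] by simp
  qed
  with \<phi> show thesis by (rule that)
qed

lemma frame_coordinates:
  assumes "a \<bullet> cross3 u v \<noteq> 0"
  shows "cross3 u v \<bullet> (w *\<^sub>R a + x *\<^sub>R u + y *\<^sub>R v) / (a \<bullet> cross3 u v) = w"
    and "cross3 v a \<bullet> (w *\<^sub>R a + x *\<^sub>R u + y *\<^sub>R v) / (a \<bullet> cross3 u v) = x"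
    and "cross3 a u \<bullet> (w *\<^sub>R a + x *\<^sub>R u + y *\<^sub>R v) / (a \<bullet> cross3 u v) = y"
proof -
  have "cross3 v a \<bullet> u = a \<bullet> cross3 u v" "cross3 a u \<bullet> v = a \<bullet> cross3 u v"
    by (simp_all add: cross3_def inner_vec_def sum_3 algebra_simps)
  then show "cross3 u v \<bullet> (w *\<^sub>R a + x *\<^sub>R u + y *\<^sub>R v) / (a \<bullet> cross3 u v) = w"
    "cross3 v a \<bullet> (w *\<^sub>R a + x *\<^sub>R u + y *\<^sub>R v) / (a \<bullet> cross3 u v) = x"
    "cross3 a u \<bullet> (w *\<^sub>R a + x *\<^sub>R u + y *\<^sub>R v) / (a \<bullet> cross3 u v) = y"
    using assms by (simp_all add: inner_add_right dot_cross_self inner_commute[of _ a])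
qed

text \<open>
  The plane of a chart avoids the origin, so its equation can be normalised to \<open>N \<bullet> X = 1\<close>.
\<close>

lemma projection_chart_normal:
  assumes "projection_chart G \<phi>"
  obtains N where "\<And>z. N \<bullet> \<phi> z = 1"
proof -
  obtain a u v where \<phi>: "\<And>x y. \<phi> (x, y) = a + x *\<^sub>R u + y *\<^sub>R v" and D: "a \<bullet> cross3 u v \<noteq> 0"
    using projection_chart_frame[OF assms] by metis
  have "((1 / (a \<bullet> cross3 u v)) *\<^sub>R cross3 u v) \<bullet> \<phi> z = 1" for z
    using frame_coordinates(1)[OF D, of 1 "fst z" "snd z"] \<phi>[of "fst z" "snd z"] by simp
  then show thesis by (rule that)
qed

lemma projection_chart_affine:
  assumes "projection_chart G \<phi>"
  shows "\<phi> (z + t *\<^sub>R d) = \<phi> z + t *\<^sub>R (\<phi> (z + d) - \<phi> z)"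
proof -
  obtain a u v where \<phi>: "\<And>x y. \<phi> (x, y) = a + x *\<^sub>R u + y *\<^sub>R v"
    using projection_chart_frame[OF assms] by metis
  have "\<phi> (fst z + t * fst d, snd z + t * snd d)
      = \<phi> (fst z, snd z) + t *\<^sub>R (\<phi> (fst z + fst d, snd z + snd d) - \<phi> (fst z, snd z))"
    unfolding \<phi> by (simp add: algebra_simps)
  then show ?thesis by (simp add: plus_prod_def scaleR_prod_def)
qed

text \<open>
  The function \<open>F\<close> is the homogenisation of \<open>f\<close>, viewed on three-space without choosing
  coordinates. The equation fixes it on all multiples of points of the chart plane, that is, off the
  plane through the origin parallel to it; there continuity determines the values, which are the leading
  part of \<open>f\<close>.
\<close>

definition cone_extension ::
    "(real \<times> real \<Rightarrow> real^3) \<Rightarrow> nat \<Rightarrow> real poly poly \<Rightarrow> (real^3 \<Rightarrow> real) \<Rightarrow> bool" where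
  "cone_extension \<phi> n f F \<longleftrightarrow>
     continuous_on UNIV F \<and> (\<forall>s z. F (s *\<^sub>R \<phi> z) = s ^ n * poly2 f z)"

text \<open>
  In the coordinates \<open>(W, X, Y)\<close> belonging to the frame of the chart, this is the usual
  homogenisation of a polynomial, which supplements each monomial by a power of \<open>W\<close>.
\<close>

lemma cone_extension_exists:
  assumes chart: "projection_chart G \<phi>" and f: "total_degree_le f n"
  obtains F where "cone_extension \<phi> n f F"
proof -
  obtain a u v where \<phi>: "\<And>x y. \<phi> (x, y) = a + x *\<^sub>R u + y *\<^sub>R v" and D: "a \<bullet> cross3 u v \<noteq> 0"
    using projection_chart_frame[OF chart] by metis
  define W X Y where "W p = cross3 u v \<bullet> p / (a \<bullet> cross3 u v)"
    and "X p = cross3 v a \<bullet> p / (a \<bullet> cross3 u v)"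
    and "Y p = cross3 a u \<bullet> p / (a \<bullet> cross3 u v)" for p
  define F where "F p = (\<Sum>j\<le>n. \<Sum>i\<le>n.
      coeff (coeff f j) i * (X p ^ i * Y p ^ j * W p ^ (n - i - j)))" for p
  have "continuous_on UNIV F"
    unfolding F_def W_def X_def Y_def by (intro continuous_intros) (use D in auto)
  moreover have "F (s *\<^sub>R \<phi> z) = s ^ n * poly2 f z" for s z
  proof -
    obtain x y where z: "z = (x, y)" by (cases z)
    have "s *\<^sub>R \<phi> z = s *\<^sub>R a + (s * x) *\<^sub>R u + (s * y) *\<^sub>R v"
      by (simp add: z \<phi> scaleR_add_right)
    then have c: "W (s *\<^sub>R \<phi> z) = s" "X (s *\<^sub>R \<phi> z) = s * x" "Y (s *\<^sub>R \<phi> z) = s * y"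
      by (simp_all add: W_def X_def Y_def frame_coordinates[OF D])
    have summand: "coeff (coeff f j) i * ((s * x) ^ i * (s * y) ^ j * s ^ (n - i - j))
        = s ^ n * (coeff (coeff f j) i * (x ^ i * y ^ j))" for i j
    proof (cases "coeff (coeff f j) i = 0")
      case False
      then have "i + j \<le> n" using f unfolding total_degree_le_def by blast
      then have "s ^ n = s ^ i * s ^ j * s ^ (n - i - j)" by (simp flip: power_add)
      then show ?thesis by (simp add: power_mult_distrib)
    qed simp
    show ?thesis
      unfolding F_def c unfolding z poly2_eq_sum[OF f] sum_distrib_left summand ..
  qed
  ultimately show thesis using that unfolding cone_extension_def by blast
qed

lemma continuous_eq_at_0:
  fixes g h :: "real \<Rightarrow> real"
  assumes "continuous_on UNIV g" "continuous_on UNIV h" and "\<And>w. w \<noteq> 0 \<Longrightarrow> g w = h w"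
  shows "g w = h w"
proof (cases "w = 0")
  case True
  have "(g \<longlongrightarrow> g 0) (at 0)" "(h \<longlongrightarrow> h 0) (at 0)"
    using assms(1,2) by (auto simp: continuous_on_def)
  moreover have "\<forall>\<^sub>F w in at 0. g w = h w"
    by (simp add: eventually_at_filter assms(3))
  ultimately have "g 0 = h 0"
    using tendsto_cong tendsto_unique trivial_limit_at by metis
  then show ?thesis using True by simp
qed (use assms(3) in simp)

text \<open>
  Homogenising a factorisation along a line: the identity is clear for \<open>w \<noteq> 0\<close>, and the remaining
  case \<open>w = 0\<close>, the point at infinity of the line, follows by continuity.
\<close>

lemma cone_extension_on_line:
  assumes chart: "projection_chart G \<phi>" and F: "cone_extension \<phi> n f F"
    and f: "\<And>t. poly2 f (z + t *\<^sub>R d) = c * (\<Prod>k=1..n. t - \<tau> k)"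
  shows "F (w *\<^sub>R \<phi> z + s *\<^sub>R (\<phi> (z + d) - \<phi> z)) = c * (\<Prod>k=1..n. s - w * \<tau> k)"
proof (rule continuous_eq_at_0[of "\<lambda>w. F (w *\<^sub>R \<phi> z + s *\<^sub>R (\<phi> (z + d) - \<phi> z))"
      "\<lambda>w. c * (\<Prod>k=1..n. s - w * \<tau> k)"])
  have F': "continuous_on UNIV F" using F unfolding cone_extension_def by blast
  show "continuous_on UNIV (\<lambda>w. F (w *\<^sub>R \<phi> z + s *\<^sub>R (\<phi> (z + d) - \<phi> z)))"
    by (rule continuous_on_compose2[OF F']) (auto intro!: continuous_intros)
  show "continuous_on UNIV (\<lambda>w. c * (\<Prod>k=1..n. s - w * \<tau> k))"
    by (intro continuous_intros)
  fix w :: real assume w: "w \<noteq> 0"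
  have "F (w *\<^sub>R \<phi> z + s *\<^sub>R (\<phi> (z + d) - \<phi> z)) = F (w *\<^sub>R \<phi> (z + (s / w) *\<^sub>R d))"
    unfolding projection_chart_affine[OF chart] using w by (simp add: scaleR_add_right)
  also have "\<dots> = w ^ n * (c * (\<Prod>k=1..n. s / w - \<tau> k))"
    using F f unfolding cone_extension_def by metis
  also have "\<dots> = c * (\<Prod>k=1..n. w * (s / w - \<tau> k))" by (simp add: prod.distrib)
  also have "\<dots> = c * (\<Prod>k=1..n. s - w * \<tau> k)" using w by (simp add: right_diff_distrib)
  finally show "F (w *\<^sub>R \<phi> z + s *\<^sub>R (\<phi> (z + d) - \<phi> z)) = c * (\<Prod>k=1..n. s - w * \<tau> k)" .
qed

section \<open>Intersecting a curve with a projected line\<close>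

text \<open>
  The chart pulls the linear equation of the plane through \<open>B\<close> and \<open>C\<close> back to an affine equation in
  two variables. It is not degenerate, since a linear form that vanishes on the whole frame is zero.
\<close>

lemma projected_line:
  assumes chart: "projection_chart G \<phi>" and indep: "cross3 B C \<noteq> 0"
    and z0: "\<phi> z0 \<in> span {B, C}"
  obtains d where "d \<noteq> 0" and "\<And>z. \<phi> z \<in> span {B, C} \<longleftrightarrow> (\<exists>t. z = z0 + t *\<^sub>R d)"
proof -
  obtain a u v where \<phi>: "\<And>x y. \<phi> (x, y) = a + x *\<^sub>R u + y *\<^sub>R v" and D: "a \<bullet> cross3 u v \<noteq> 0"
    using projection_chart_frame[OF chart] by metis
  let ?m = "cross3 B C"
  obtain x0 y0 where z0_eq: "z0 = (x0, y0)" by (cases z0)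
  have plane: "X \<in> span {B, C} \<longleftrightarrow> ?m \<bullet> X = 0" for X
  proof
    assume "?m \<bullet> X = 0"
    then show "X \<in> span {B, C}"
      using plane_coord_expansion[OF indep _ _ _ indep, of X]
      unfolding in_span_pair by (metis dot_cross_self(1,2) inner_commute)
  qed (auto simp: in_span_pair inner_add_right dot_cross_self)
  define p q where "p = ?m \<bullet> u" and "q = ?m \<bullet> v"
  have m\<phi>: "?m \<bullet> \<phi> (x, y) = ?m \<bullet> a + x * p + y * q" for x y
    by (simp add: \<phi> inner_add_right p_def q_def)
  have m0: "?m \<bullet> a + x0 * p + y0 * q = 0" using z0 plane m\<phi> z0_eq by metis
  have pq: "p \<noteq> 0 \<or> q \<noteq> 0"
  proof (rule ccontr)
    assume "\<not> (p \<noteq> 0 \<or> q \<noteq> 0)"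
    then have "?m \<bullet> a = 0" "?m \<bullet> u = 0" "?m \<bullet> v = 0" using m0 by (simp_all add: p_def q_def)
    then have "(a \<bullet> cross3 u v) *\<^sub>R ?m = 0"
      using cross3_dual_basis_expansion[of a u v ?m] by simp
    then show False using D indep by simp
  qed
  show thesis
  proof (rule that[of "(q, - p)"])
    show "(q, - p) \<noteq> 0" using pq by (auto simp: zero_prod_def)
    fix z :: "real \<times> real"
    obtain x y where z: "z = (x, y)" by (cases z)
    have "\<phi> z \<in> span {B, C} \<longleftrightarrow> (x - x0) * p + (y - y0) * q = 0"
      unfolding plane z m\<phi> using m0 by (auto simp: algebra_simps)
    also have "\<dots> \<longleftrightarrow> (\<exists>t. x = x0 + t * q \<and> y = y0 - t * p)"
    proof
      assume *: "(x - x0) * p + (y - y0) * q = 0"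
      show "\<exists>t. x = x0 + t * q \<and> y = y0 - t * p"
      proof (cases "q = 0")
        case True
        with * pq show ?thesis by (intro exI[of _ "(y0 - y) / p"]) auto
      next
        case False
        with * show ?thesis by (intro exI[of _ "(x - x0) / q"]) (simp add: field_simps)
      qed
    qed (auto simp: algebra_simps)
    also have "\<dots> \<longleftrightarrow> (\<exists>t. z = z0 + t *\<^sub>R (q, - p))" by (simp add: z z0_eq)
    finally show "\<phi> z \<in> span {B, C} \<longleftrightarrow> (\<exists>t. z = z0 + t *\<^sub>R (q, - p))" .
  qed
qed

lemma order_pcompose_linear:
  fixes p :: "real poly"
  assumes "p \<noteq> 0" "\<kappa> \<noteq> 0"
  shows "order 0 (pcompose p [:\<tau>, \<kappa>:]) = order \<tau> p"
proof -
  obtain r where p: "p = [:- \<tau>, 1:] ^ order \<tau> p * r" and r: "\<not> [:- \<tau>, 1:] dvd r"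
    using order_decomp[OF assms(1)] by blast
  have pow: "pcompose (q ^ m) [:\<tau>, \<kappa>:] = pcompose q [:\<tau>, \<kappa>:] ^ m" for q m
    by (induction m) (simp_all add: pcompose_mult pcompose_1)
  have lin: "pcompose [:- \<tau>, 1:] [:\<tau>, \<kappa>:] = smult \<kappa> [:- 0, 1:]" by (simp add: pcompose_pCons)
  have eq: "pcompose p [:\<tau>, \<kappa>:]
      = smult (\<kappa> ^ order \<tau> p) ([:- 0, 1:] ^ order \<tau> p * pcompose r [:\<tau>, \<kappa>:])"
    by (subst p) (simp only: pcompose_mult pow lin smult_power mult_smult_left)
  have r0: "poly (pcompose r [:\<tau>, \<kappa>:]) 0 \<noteq> 0"
    using r by (simp add: poly_pcompose poly_eq_0_iff_dvd)
  then have "pcompose r [:\<tau>, \<kappa>:] \<noteq> 0" by auto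
  then have "order 0 ([:- 0, 1:] ^ order \<tau> p * pcompose r [:\<tau>, \<kappa>:]) = order \<tau> p"
    using r0 by (subst order_mult) (auto simp: order_power_n_n[of 0, simplified] order_0I)
  then show ?thesis unfolding eq using assms(2) by (simp add: order_smult)
qed

lemma line_poly_reparametrise:
  "line_poly f (z + \<tau> *\<^sub>R d) (\<kappa> *\<^sub>R d) = pcompose (line_poly f z d) [:\<tau>, \<kappa>:]"
  unfolding poly_eq_poly_eq_iff[symmetric]
  by (rule ext) (simp add: poly_line_poly poly_pcompose algebra_simps)

lemma order_linear_factor: "order x [:- a, 1:] = (if x = a then 1 else 0)" for x a :: real
  using order_power_n_n[of a 1] by (auto intro: order_0I)

lemma card_filter_insert:
  assumes "finite K" "a \<notin> K"
  shows "card {k \<in> insert a K. P k} = (if P a then 1 else 0) + card {k \<in> K. P k}"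
proof -
  have "{k \<in> insert a K. P k} = (if P a then insert a {k \<in> K. P k} else {k \<in> K. P k})" by auto
  then show ?thesis using assms by simp
qed

text \<open>
  The family \<open>\<tau>\<close> lists roots with repetitions, in the same way as repeated points are counted in
  \<^const>\<open>lie_on_curve\<close>.
\<close>

lemma order_prod_linear_factors:
  fixes \<tau> :: "'a \<Rightarrow> real"
  assumes "finite K"
  shows "order x (\<Prod>k\<in>K. [:- \<tau> k, 1:]) = card {k \<in> K. \<tau> k = x}"
  using assms
proof (induction K)
  case (insert a K)
  have "(\<Prod>k\<in>K. [:- \<tau> k, 1:]) \<noteq> 0" using insert.hyps by simp
  then have "[:- \<tau> a, 1:] * (\<Prod>k\<in>K. [:- \<tau> k, 1:]) \<noteq> 0" by (simp only: mult_eq_0_iff) simp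
  then show ?case
    using insert.hyps insert.IH
    by (simp add: order_mult order_linear_factor card_filter_insert
        del: mult_pCons_left insert_iff)
qed simp

lemma prod_linear_factors_dvd:
  fixes p :: "real poly"
  assumes "finite K" "p \<noteq> 0" "\<And>k. k \<in> K \<Longrightarrow> card {j \<in> K. \<tau> j = \<tau> k} \<le> order (\<tau> k) p"
  shows "(\<Prod>k\<in>K. [:- \<tau> k, 1:]) dvd p"
  using assms
proof (induction K arbitrary: p)
  case (insert a K)
  have "1 \<le> order (\<tau> a) p"
    using insert.prems(2)[of a] insert.hyps
    by (simp add: card_filter_insert del: insert_iff) simp
  then have "[:- \<tau> a, 1:] dvd p" using order_divides[of "\<tau> a" 1 p] by simp
  then obtain q where p: "p = [:- \<tau> a, 1:] * q" ..
  have "card {j \<in> K. \<tau> j = \<tau> k} \<le> order (\<tau> k) q" if "k \<in> K" for k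
    using insert.prems(2)[of k] insert.hyps that order_mult[OF insert.prems(1)[unfolded p], of "\<tau> k"]
    unfolding p[symmetric] card_filter_insert[OF insert.hyps] order_linear_factor
    by (auto split: if_splits)
  moreover have "q \<noteq> 0" using insert.prems(1) p by auto
  ultimately have "(\<Prod>k\<in>K. [:- \<tau> k, 1:]) dvd q" using insert.IH by blast
  then show ?case using insert.hyps unfolding p by (simp add: mult_dvd_mono del: mult_pCons_left)
qed simp

text \<open>
  The degree bound leaves room for no further factor but a constant.
\<close>

lemma root_multiplicities_iff:
  fixes p :: "real poly"
  assumes "degree p \<le> n"
  shows "p \<noteq> 0 \<and> (\<forall>k\<in>{1..n}. card {j \<in> {1..n}. \<tau> j = \<tau> k} \<le> order (\<tau> k) p)
     \<longleftrightarrow> (\<exists>c. c \<noteq> 0 \<and> p = smult c (\<Prod>k=1..n. [:- \<tau> k, 1:]))"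
proof
  assume *: "p \<noteq> 0 \<and> (\<forall>k\<in>{1..n}. card {j \<in> {1..n}. \<tau> j = \<tau> k} \<le> order (\<tau> k) p)"
  then have "(\<Prod>k=1..n. [:- \<tau> k, 1:]) dvd p" by (intro prod_linear_factors_dvd) auto
  then obtain r where p: "p = (\<Prod>k=1..n. [:- \<tau> k, 1:]) * r" ..
  have "r \<noteq> 0" using * p by auto
  moreover have deg: "degree (\<Prod>k=1..n. [:- \<tau> k, 1:]) = n"
    by (subst degree_prod_eq_sum_degree) auto
  ultimately have "degree p = n + degree r"
    unfolding p by (subst degree_mult_eq) auto
  then have "degree r = 0" using assms by simp
  then obtain c where r: "r = [:c:]" by (rule degree_eq_zeroE)
  then have "p = smult c (\<Prod>k=1..n. [:- \<tau> k, 1:])" by (simp add: p)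
  then show "\<exists>c. c \<noteq> 0 \<and> p = smult c (\<Prod>k=1..n. [:- \<tau> k, 1:])" using r \<open>r \<noteq> 0\<close> by auto
next
  assume "\<exists>c. c \<noteq> 0 \<and> p = smult c (\<Prod>k=1..n. [:- \<tau> k, 1:])"
  then obtain c where "c \<noteq> 0" "p = smult c (\<Prod>k=1..n. [:- \<tau> k, 1:])" by blast
  then show "p \<noteq> 0 \<and> (\<forall>k\<in>{1..n}. card {j \<in> {1..n}. \<tau> j = \<tau> k} \<le> order (\<tau> k) p)"
    by (auto simp: order_smult order_prod_linear_factors)
qed

lemma degree_line_poly:
  assumes "total_degree_le f n"
  shows "degree (line_poly f z d) \<le> n"
proof -
  let ?g = "map_poly (\<lambda>q. pcompose q [:fst z, fst d:]) f"
  have "line_poly f z d = (\<Sum>j\<le>degree f. pcompose (coeff f j) [:fst z, fst d:] * [:snd z, snd d:] ^ j)"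
  proof -
    have "degree ?g \<le> degree f" by (rule map_poly_degree_leq)
    then show ?thesis unfolding line_poly_def by (simp add: poly_eq_sum_upto coeff_map_poly)
  qed
  moreover have "degree (pcompose (coeff f j) [:fst z, fst d:] * [:snd z, snd d:] ^ j) \<le> n" for j
  proof (cases "coeff f j = 0")
    case False
    then have "degree (coeff f j) + j \<le> n"
      using assms leading_coeff_0_iff unfolding total_degree_le_def by blast
    moreover have "degree (pcompose (coeff f j) [:fst z, fst d:]) \<le> degree (coeff f j)"
      using degree_pcompose_le[of "coeff f j" "[:fst z, fst d:]"] degree_pCons_le[of "fst z" "[:fst d:]"]
      by (metis One_nat_def degree_pCons_0 le_trans mult.right_neutral mult_le_mono2)
    moreover have "degree ([:snd z, snd d:] ^ j) \<le> j"
      using degree_power_le[of "[:snd z, snd d:]" j] degree_pCons_le[of "snd z" "[:snd d:]"]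
      by (metis One_nat_def degree_pCons_0 le_trans mult_1 mult_le_mono1)
    ultimately show ?thesis
      using degree_mult_le[of "pcompose (coeff f j) [:fst z, fst d:]" "[:snd z, snd d:] ^ j"] by linarith
  qed simp
  ultimately show ?thesis by (simp add: degree_sum_le)
qed

text \<open>
  Since projections are unique, the coordinates \<open>q k\<close> in the definition of \<^const>\<open>lie_on_curve\<close> are
  determined by the points.
\<close>

lemma central_projection_unique:
  assumes chart: "projection_chart G \<phi>"
    and "central_projection (range \<phi>) P (\<phi> z)" "central_projection (range \<phi>) P (\<phi> z')"
  shows "z = z'"
proof -
  obtain N where N: "\<And>z. N \<bullet> \<phi> z = 1" using projection_chart_normal[OF chart] by metis
  obtain s s' where s: "\<phi> z = s *\<^sub>R P" "\<phi> z' = s' *\<^sub>R P"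
    using assms(2,3) unfolding central_projection_def span_singleton by auto
  have "s * (N \<bullet> P) = 1" "s' * (N \<bullet> P) = 1" using N[of z] N[of z'] s by simp_all
  then have "s = s'" by (metis mult_cancel_right mult_zero_right zero_neq_one)
  then have "\<phi> z = \<phi> z'" using s by simp
  then show ?thesis using chart unfolding projection_chart_def by (simp add: inj_eq)
qed

text \<open>
  Replacing the chosen direction by a multiple, and the base point by another point of the line,
  substitutes a linear polynomial, which only moves the root.
\<close>

lemma intersection_mult_eq_order:
  assumes chart: "projection_chart G \<phi>" and "d \<noteq> 0"
    and line: "\<And>z. \<phi> z \<in> span L \<longleftrightarrow> (\<exists>t. z = z0 + t *\<^sub>R d)"
    and "line_poly f z0 d \<noteq> 0"
  shows "intersection_mult \<phi> f L (z0 + \<tau> *\<^sub>R d) = order \<tau> (line_poly f z0 d)"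
proof -
  let ?P = "\<lambda>e. e \<noteq> 0 \<and> \<phi> (z0 + \<tau> *\<^sub>R d + e) \<in> span L"
  have "?P d" using assms(2) line by (auto intro!: exI[of _ "\<tau> + 1"] simp: scaleR_add_left)
  then have *: "?P (SOME e. ?P e)" by (rule someI)
  then obtain t where "z0 + \<tau> *\<^sub>R d + (SOME e. ?P e) = z0 + t *\<^sub>R d" using line by blast
  then have "(SOME e. ?P e) = (t - \<tau>) *\<^sub>R d" by (simp add: algebra_simps)
  moreover from this have "t - \<tau> \<noteq> 0" using * by auto
  ultimately show ?thesis
    unfolding intersection_mult_def
    by (simp add: line_poly_reparametrise order_pcompose_linear assms(4))
qed

lemma lie_on_curve_iff_multiplicities:
  assumes chart: "projection_chart G \<phi>" and f: "total_degree_le f n" and "d \<noteq> 0"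
    and line: "\<And>z. \<phi> z \<in> span L \<longleftrightarrow> (\<exists>t. z = z0 + t *\<^sub>R d)"
    and proj: "\<And>k. k \<in> {1..n} \<Longrightarrow> central_projection (range \<phi>) (P k) (\<phi> (z0 + \<tau> k *\<^sub>R d))"
  shows "lie_on_curve \<phi> f L n P \<longleftrightarrow>
    (\<exists>c. c \<noteq> 0 \<and> line_poly f z0 d = smult c (\<Prod>k=1..n. [:- \<tau> k, 1:]))"
proof -
  let ?l = "line_poly f z0 d"
  define q where "q k = z0 + \<tau> k *\<^sub>R d" for k
  have q_eq: "q j = q k \<longleftrightarrow> \<tau> j = \<tau> k" for j k using \<open>d \<noteq> 0\<close> by (simp add: q_def)
  have contains: "contains_line \<phi> f L \<longleftrightarrow> ?l = 0"
  proof -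
    have "contains_line \<phi> f L \<longleftrightarrow> (\<forall>t. poly ?l t = 0)"
      unfolding contains_line_def line poly_line_poly by blast
    then show ?thesis by (simp add: poly_all_0_iff_0)
  qed
  have "lie_on_curve \<phi> f L n P \<longleftrightarrow>
      ?l \<noteq> 0 \<and> (\<forall>k\<in>{1..n}. card {j \<in> {1..n}. \<tau> j = \<tau> k} \<le> order (\<tau> k) ?l)"
  proof
    assume "lie_on_curve \<phi> f L n P"
    then obtain q' where l: "?l \<noteq> 0"
      and proj': "\<And>k. k \<in> {1..n} \<Longrightarrow> central_projection (range \<phi>) (P k) (\<phi> (q' k))"
      and mult: "\<And>k. k \<in> {1..n} \<Longrightarrow> card {j\<in>{1..n}. q' j = q' k} \<le> intersection_mult \<phi> f L (q' k)"
      unfolding lie_on_curve_def contains by blast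
    have q': "q' k = q k" if "k \<in> {1..n}" for k
      using central_projection_unique[OF chart proj'[OF that] proj[OF that]] by (simp add: q_def)
    have "card {j\<in>{1..n}. \<tau> j = \<tau> k} \<le> order (\<tau> k) ?l" if k: "k \<in> {1..n}" for k
    proof -
      have "{j\<in>{1..n}. q' j = q' k} = {j\<in>{1..n}. \<tau> j = \<tau> k}" using q' k q_eq by auto
      then show ?thesis
        using mult[OF k] q'[OF k] intersection_mult_eq_order[OF chart \<open>d \<noteq> 0\<close> line l]
        by (simp add: q_def)
    qed
    then show "?l \<noteq> 0 \<and> (\<forall>k\<in>{1..n}. card {j \<in> {1..n}. \<tau> j = \<tau> k} \<le> order (\<tau> k) ?l)"
      using l by blast
  next
    assume *: "?l \<noteq> 0 \<and> (\<forall>k\<in>{1..n}. card {j \<in> {1..n}. \<tau> j = \<tau> k} \<le> order (\<tau> k) ?l)"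
    then have l: "?l \<noteq> 0" by blast
    have "central_projection (range \<phi>) (P k) (\<phi> (q k)) \<and> poly2 f (q k) = 0 \<and>
        card {j\<in>{1..n}. q j = q k} \<le> intersection_mult \<phi> f L (q k)" if k: "k \<in> {1..n}" for k
    proof -
      have m: "card {j\<in>{1..n}. q j = q k} \<le> order (\<tau> k) ?l" using * k unfolding q_eq by blast
      have "card {j\<in>{1..n}. q j = q k} \<noteq> 0" using k by auto
      with m have "order (\<tau> k) ?l \<noteq> 0" by linarith
      then have "poly ?l (\<tau> k) = 0" by (simp add: order_root)
      then show ?thesis
        using m proj[OF k] intersection_mult_eq_order[OF chart \<open>d \<noteq> 0\<close> line l]
        by (simp add: poly_line_poly q_def)
    qed
    then show "lie_on_curve \<phi> f L n P"
      unfolding lie_on_curve_def contains using l by blast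
  qed
  then show ?thesis using root_multiplicities_iff[OF degree_line_poly[OF f]] by simp
qed

lemma independent_coefficients:
  assumes "cross3 B C \<noteq> 0" "y *\<^sub>R B + z *\<^sub>R C = y' *\<^sub>R B + z' *\<^sub>R C"
  shows "y = y'" "z = z'"
  using arg_cong[OF assms(2), of "plane_coord B C"] arg_cong[OF assms(2), of "plane_coord C B"]
  by (simp_all add: plane_coord_combination[OF assms(1)])

text \<open>
  The bridge between curves and algebra. Along the projected line the condition says that \<open>f\<close>
  is a constant times a product of linear factors with the prescribed roots. Passing from the affine
  parameter on the projected line to the homogeneous coordinates \<open>y\<close> and \<open>z\<close> with respect to \<open>B\<close> and
  \<open>C\<close> is a linear substitution, which rescales each factor: the factors \<open>y - t k * z\<close> and
  \<open>s - w * \<tau> k\<close> both vanish exactly on the line through the origin and \<open>P k\<close>. Repeated points cause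
  no difficulty in this form.
\<close>

lemma lie_on_curve_iff:
  assumes chart: "projection_chart G \<phi>" and F: "cone_extension \<phi> n f F"
    and f: "total_degree_le f n" and n: "n \<ge> 1"
    and indep: "cross3 B C \<noteq> 0" and L: "span L = span {B, C}"
    and P: "\<And>k. k \<in> {1..n} \<Longrightarrow> P k = \<mu> k *\<^sub>R (t k *\<^sub>R B + C)"
    and proj: "\<And>k. k \<in> {1..n} \<Longrightarrow> central_projection (range \<phi>) (P k) (\<phi> (q k))"
  shows "lie_on_curve \<phi> f L n P \<longleftrightarrow>
    (\<exists>c. c \<noteq> 0 \<and> (\<forall>y z. F (y *\<^sub>R B + z *\<^sub>R C) = c * (\<Prod>k=1..n. y - t k * z)))"
proof -
  obtain N where N: "\<And>z. N \<bullet> \<phi> z = 1" using projection_chart_normal[OF chart] by metis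
  have "\<exists>\<sigma>. \<phi> (q k) = \<sigma> *\<^sub>R (t k *\<^sub>R B + C)" if k: "k \<in> {1..n}" for k
    using proj[OF k] unfolding central_projection_def P[OF k] span_singleton by auto
  then obtain \<sigma> where \<sigma>: "\<And>k. k \<in> {1..n} \<Longrightarrow> \<phi> (q k) = \<sigma> k *\<^sub>R (t k *\<^sub>R B + C)" by metis
  have q_plane: "\<phi> (q k) \<in> span {B, C}" if "k \<in> {1..n}" for k
  proof -
    have "\<phi> (q k) = (\<sigma> k * t k) *\<^sub>R B + \<sigma> k *\<^sub>R C"
      using \<sigma>[OF that] by (simp add: scaleR_add_right)
    then show ?thesis unfolding in_span_pair by blast
  qed
  define z0 where "z0 = q 1"
  have z0: "\<phi> z0 \<in> span {B, C}" using q_plane[of 1] n by (simp add: z0_def)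
  obtain d where d: "d \<noteq> 0" and line: "\<And>z. \<phi> z \<in> span {B, C} \<longleftrightarrow> (\<exists>t. z = z0 + t *\<^sub>R d)"
    using projected_line[OF chart indep z0] by metis
  have "\<exists>\<tau>. q k = z0 + \<tau> *\<^sub>R d" if "k \<in> {1..n}" for k using q_plane[OF that] line by blast
  then obtain \<tau> where \<tau>: "\<And>k. k \<in> {1..n} \<Longrightarrow> q k = z0 + \<tau> k *\<^sub>R d" by metis
  define e where "e = \<phi> (z0 + d) - \<phi> z0"
  have \<phi>_line: "\<phi> (z0 + t *\<^sub>R d) = \<phi> z0 + t *\<^sub>R e" for t
    unfolding e_def by (rule projection_chart_affine[OF chart])
  have "\<phi> (z0 + d) \<in> span {B, C}" using line by (auto intro: exI[of _ 1])
  then have "e \<in> span {B, C}" unfolding e_def using z0 by (rule span_diff)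
  with z0 obtain y0 w0 y1 w1 where z0_eq: "\<phi> z0 = y0 *\<^sub>R B + w0 *\<^sub>R C"
    and e_eq: "e = y1 *\<^sub>R B + w1 *\<^sub>R C"
    unfolding in_span_pair by blast
  have comb: "w *\<^sub>R \<phi> z0 + s *\<^sub>R e
      = (w * y0 + s * y1) *\<^sub>R B + (w * w0 + s * w1) *\<^sub>R C" for w s
    unfolding z0_eq e_eq by (simp add: algebra_simps)
  have e0: "e \<noteq> 0"
    using chart d unfolding e_def projection_chart_def by (simp add: inj_eq)
  have indep': "w = 0 \<and> s = 0" if "w *\<^sub>R \<phi> z0 + s *\<^sub>R e = 0" for w s
  proof -
    have "N \<bullet> e = 0" by (simp add: e_def inner_diff_right N)
    then have "w = 0" using arg_cong[OF that, of "\<lambda>v. N \<bullet> v"] by (simp add: inner_add_right N)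
    then show ?thesis using that e0 by simp
  qed
  define \<delta> where "\<delta> = y0 * w1 - w0 * y1"
  have \<delta>: "\<delta> \<noteq> 0"
  proof
    assume "\<delta> = 0"
    then have "w1 *\<^sub>R \<phi> z0 + (- w0) *\<^sub>R e = 0" "y1 *\<^sub>R \<phi> z0 + (- y0) *\<^sub>R e = 0"
      unfolding comb by (simp_all add: \<delta>_def algebra_simps)
    then have "w1 = 0" "y1 = 0" using indep' by blast+
    then show False using e0 e_eq by simp
  qed
  \<comment> \<open>\<open>\<kappa> k\<close> is the ratio between the factors \<open>y - t k * z\<close> and \<open>s - w * \<tau> k\<close>.\<close>
  define \<kappa> where "\<kappa> k = y1 - t k * w1" for k
  have root: "y0 - t k * w0 = - \<tau> k * \<kappa> k" and \<kappa>: "\<kappa> k \<noteq> 0" if k: "k \<in> {1..n}" for k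
  proof -
    have "(y0 + \<tau> k * y1) *\<^sub>R B + (w0 + \<tau> k * w1) *\<^sub>R C = (\<sigma> k * t k) *\<^sub>R B + \<sigma> k *\<^sub>R C"
      using \<sigma>[OF k] \<tau>[OF k] \<phi>_line[of "\<tau> k"] comb[of 1 "\<tau> k"] by (simp add: scaleR_add_right)
    from independent_coefficients[OF indep this]
    have "y0 + \<tau> k * y1 = t k * (w0 + \<tau> k * w1)" by (simp add: mult.commute)
    then show *: "y0 - t k * w0 = - \<tau> k * \<kappa> k" by (simp add: \<kappa>_def algebra_simps)
    show "\<kappa> k \<noteq> 0"
    proof
      assume "\<kappa> k = 0"
      then have "y1 = t k * w1" "y0 = t k * w0" using * by (simp_all add: \<kappa>_def)
      then show False using \<delta> by (simp add: \<delta>_def)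
    qed
  qed
  have factor: "(w * y0 + s * y1) - t k * (w * w0 + s * w1) = \<kappa> k * (s - w * \<tau> k)"
    if k: "k \<in> {1..n}" for k w s
  proof -
    have "(w * y0 + s * y1) - t k * (w * w0 + s * w1) = w * (y0 - t k * w0) + s * \<kappa> k"
      by (simp add: \<kappa>_def algebra_simps)
    then show ?thesis unfolding root[OF k] by (simp add: algebra_simps)
  qed
  define \<rho> where "\<rho> = (\<Prod>k=1..n. \<kappa> k)"
  have \<rho>: "\<rho> \<noteq> 0" using \<kappa> by (simp add: \<rho>_def)
  have factors: "(\<Prod>k=1..n. (w * y0 + s * y1) - t k * (w * w0 + s * w1))
      = \<rho> * (\<Prod>k=1..n. s - w * \<tau> k)" for w s
    unfolding \<rho>_def prod.distrib[symmetric] by (intro prod.cong refl factor)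
  have "lie_on_curve \<phi> f L n P \<longleftrightarrow>
      (\<exists>c. c \<noteq> 0 \<and> line_poly f z0 d = smult c (\<Prod>k=1..n. [:- \<tau> k, 1:]))"
    using proj \<tau> line by (intro lie_on_curve_iff_multiplicities[OF chart f d]) (auto simp: L)
  also have "\<dots> \<longleftrightarrow>
    (\<exists>c. c \<noteq> 0 \<and> (\<forall>y z. F (y *\<^sub>R B + z *\<^sub>R C) = c * (\<Prod>k=1..n. y - t k * z)))"
  proof
    assume "\<exists>c. c \<noteq> 0 \<and> line_poly f z0 d = smult c (\<Prod>k=1..n. [:- \<tau> k, 1:])"
    then obtain c where c: "c \<noteq> 0" and l: "line_poly f z0 d = smult c (\<Prod>k=1..n. [:- \<tau> k, 1:])"
      by blast
    have f_line: "poly2 f (z0 + s *\<^sub>R d) = c * (\<Prod>k=1..n. s - \<tau> k)" for s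
      unfolding poly_line_poly[symmetric] l by (simp add: poly_prod)
    have "F (y *\<^sub>R B + z *\<^sub>R C) = (c / \<rho>) * (\<Prod>k=1..n. y - t k * z)" for y z
    proof -
      \<comment> \<open>Cramer's rule for the change of basis from \<open>\<phi> z0, e\<close> to \<open>B, C\<close>.\<close>
      define w s where "w = (y * w1 - z * y1) / \<delta>" and "s = (y0 * z - w0 * y) / \<delta>"
      have "y * \<delta> = (w * y0 + s * y1) * \<delta>" "z * \<delta> = (w * w0 + s * w1) * \<delta>"
        using \<delta> unfolding w_def s_def by (simp_all add: field_simps) (simp_all add: \<delta>_def algebra_simps)
      then have y: "y = w * y0 + s * y1" and z: "z = w * w0 + s * w1" using \<delta> by simp_all
      have "F (y *\<^sub>R B + z *\<^sub>R C) = c * (\<Prod>k=1..n. s - w * \<tau> k)"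
        using cone_extension_on_line[OF chart F f_line, of w s]
        unfolding y z comb[symmetric] e_def .
      then show ?thesis unfolding y z factors using \<rho> by simp
    qed
    moreover have "c / \<rho> \<noteq> 0" using c \<rho> by simp
    ultimately show "\<exists>c. c \<noteq> 0 \<and> (\<forall>y z. F (y *\<^sub>R B + z *\<^sub>R C) = c * (\<Prod>k=1..n. y - t k * z))"
      by blast
  next
    assume "\<exists>c. c \<noteq> 0 \<and> (\<forall>y z. F (y *\<^sub>R B + z *\<^sub>R C) = c * (\<Prod>k=1..n. y - t k * z))"
    then obtain c where c: "c \<noteq> 0"
      and Fc: "\<And>y z. F (y *\<^sub>R B + z *\<^sub>R C) = c * (\<Prod>k=1..n. y - t k * z)" by blast
    have "poly (line_poly f z0 d) s = poly (smult (c * \<rho>) (\<Prod>k=1..n. [:- \<tau> k, 1:])) s" for s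
    proof -
      have "poly (line_poly f z0 d) s = F (1 *\<^sub>R \<phi> (z0 + s *\<^sub>R d))"
        using F unfolding cone_extension_def poly_line_poly by (metis mult_1 power_one)
      also have "\<dots> = F (1 *\<^sub>R \<phi> z0 + s *\<^sub>R e)" by (simp add: \<phi>_line)
      also have "\<dots> = c * (\<rho> * (\<Prod>k=1..n. s - 1 * \<tau> k))" unfolding comb Fc factors ..
      finally show ?thesis by (simp add: poly_prod)
    qed
    then have "line_poly f z0 d = smult (c * \<rho>) (\<Prod>k=1..n. [:- \<tau> k, 1:])"
      by (intro poly_eq_poly_eq_iff[THEN iffD1] ext)
    then show "\<exists>c. c \<noteq> 0 \<and> line_poly f z0 d = smult c (\<Prod>k=1..n. [:- \<tau> k, 1:])"
      using c \<rho> by (intro exI[of _ "c * \<rho>"]) simp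
  qed
  finally show ?thesis .
qed

text \<open>
  Evaluating the product form at the two vertices, where it is the constant or the constant times
  the product of the negated parameters.
\<close>

lemma lie_on_curve_vertex_values:
  assumes chart: "projection_chart G \<phi>" and F: "cone_extension \<phi> n f F"
    and f: "total_degree_le f n" and n: "n \<ge> 1"
    and indep: "cross3 B C \<noteq> 0" and L: "span L = span {B, C}"
    and P: "\<And>k. k \<in> {1..n} \<Longrightarrow> P k = \<mu> k *\<^sub>R (t k *\<^sub>R B + C)"
    and lie: "lie_on_curve \<phi> f L n P"
  shows "F B \<noteq> 0" "F C = F B * (\<Prod>k=1..n. - t k)"
proof -
  obtain q where q: "\<And>k. k \<in> {1..n} \<Longrightarrow> central_projection (range \<phi>) (P k) (\<phi> (q k))"
    using lie unfolding lie_on_curve_def by blast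
  have "lie_on_curve \<phi> f L n P \<longleftrightarrow>
      (\<exists>c. c \<noteq> 0 \<and> (\<forall>y z. F (y *\<^sub>R B + z *\<^sub>R C) = c * (\<Prod>k=1..n. y - t k * z)))"
    by (rule lie_on_curve_iff[OF chart F f n indep L P q])
  from iffD1[OF this lie] obtain c where c: "c \<noteq> 0"
    and Fc: "\<And>y z. F (y *\<^sub>R B + z *\<^sub>R C) = c * (\<Prod>k=1..n. y - t k * z)"
    by blast
  have "F B = c" using Fc[of 1 0] by simp
  moreover have "F C = c * (\<Prod>k=1..n. - t k)" using Fc[of 0 1] by simp
  ultimately show "F B \<noteq> 0" "F C = F B * (\<Prod>k=1..n. - t k)" using c by simp_all
qed

section \<open>Constructing a curve through given points\<close>

text \<open>
  The homogeneous functions of degree \<open>n\<close> that arise from polynomials on the chart. Using a bound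
  on the total degree, rather than the exact degree, makes them closed under sums.
\<close>

definition polynomial_form :: "(real \<times> real \<Rightarrow> real^3) \<Rightarrow> nat \<Rightarrow> (real^3 \<Rightarrow> real) \<Rightarrow> bool" where
  "polynomial_form \<phi> n F \<longleftrightarrow> (\<exists>f. total_degree_le f n \<and> cone_extension \<phi> n f F)"

lemma polynomial_form_const: "polynomial_form \<phi> 0 (\<lambda>X. c)"
proof -
  have "total_degree_le [:[:c:]:] 0"
    unfolding total_degree_le_def by (auto simp: coeff_pCons split: nat.splits)
  moreover have "cone_extension \<phi> 0 [:[:c:]:] (\<lambda>X. c)"
    by (simp add: cone_extension_def poly2_arith)
  ultimately show ?thesis unfolding polynomial_form_def by blast
qed

lemma polynomial_form_linear:
  assumes "projection_chart G \<phi>"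
  shows "polynomial_form \<phi> 1 (\<lambda>X. h \<bullet> X)"
proof -
  obtain a u v where \<phi>: "\<And>x y. \<phi> (x, y) = a + x *\<^sub>R u + y *\<^sub>R v"
    using projection_chart_frame[OF assms] by metis
  let ?f = "[:[:h \<bullet> a, h \<bullet> u:], [:h \<bullet> v:]:]"
  have "total_degree_le ?f 1"
    unfolding total_degree_le_def by (auto simp: coeff_pCons split: nat.splits)
  moreover have "poly2 ?f z = h \<bullet> \<phi> z" for z
    by (cases z) (simp add: poly2_def \<phi> inner_add_right)
  then have "cone_extension \<phi> 1 ?f (\<lambda>X. h \<bullet> X)"
    by (simp add: cone_extension_def continuous_intros)
  ultimately show ?thesis unfolding polynomial_form_def by blast
qed

lemma polynomial_form_add:
  assumes "polynomial_form \<phi> n F" "polynomial_form \<phi> n G"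
  shows "polynomial_form \<phi> n (\<lambda>X. F X + G X)"
proof -
  obtain f g where "total_degree_le f n" "cone_extension \<phi> n f F"
    "total_degree_le g n" "cone_extension \<phi> n g G"
    using assms unfolding polynomial_form_def by blast
  then have "total_degree_le (f + g) n" "cone_extension \<phi> n (f + g) (\<lambda>X. F X + G X)"
    by (simp_all add: total_degree_le_add cone_extension_def continuous_on_add poly2_arith
        distrib_left)
  then show ?thesis unfolding polynomial_form_def by blast
qed

lemma polynomial_form_mult:
  assumes "polynomial_form \<phi> m F" "polynomial_form \<phi> n G"
  shows "polynomial_form \<phi> (m + n) (\<lambda>X. F X * G X)"
proof -
  obtain f g where "total_degree_le f m" "cone_extension \<phi> m f F"
    "total_degree_le g n" "cone_extension \<phi> n g G"
    using assms unfolding polynomial_form_def by blast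
  then have "total_degree_le (f * g) (m + n)" "cone_extension \<phi> (m + n) (f * g) (\<lambda>X. F X * G X)"
    by (simp_all add: total_degree_le_mult cone_extension_def continuous_on_mult poly2_arith
        power_add)
  then show ?thesis unfolding polynomial_form_def by blast
qed

lemma polynomial_form_prod_linear:
  assumes "projection_chart G \<phi>"
  shows "polynomial_form \<phi> n (\<lambda>X. c * (\<Prod>k=1..n. h k \<bullet> X))"
proof (induction n)
  case 0
  then show ?case using polynomial_form_const[of \<phi> c] by simp
next
  case (Suc n)
  have "polynomial_form \<phi> (n + 1) (\<lambda>X. (c * (\<Prod>k=1..n. h k \<bullet> X)) * (h (Suc n) \<bullet> X))"
    by (rule polynomial_form_mult[OF Suc polynomial_form_linear[OF assms]])
  then show ?case by (simp add: mult.assoc)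
qed

text \<open>
  If the degree of \<open>f\<close> dropped, \<open>f\<close> would also extend to a homogeneous
  function \<open>F'\<close> of degree \<open>n - 1\<close>, and \<open>F\<close> would be \<open>F'\<close> times the linear form \<open>N \<bullet> X\<close>, hence zero
  wherever \<open>N \<bullet> X = 0\<close>.
\<close>

lemma has_total_degree_if_nonzero_at_infinity:
  assumes chart: "projection_chart G \<phi>" and range: "range \<phi> = {X. N \<bullet> X = 1}"
    and f: "total_degree_le f n" and F: "cone_extension \<phi> n f F" and n: "n \<ge> 1"
    and V: "N \<bullet> V = 0" "F V \<noteq> 0"
  shows "has_total_degree f n"
proof (rule ccontr)
  assume "\<not> has_total_degree f n"
  then have "\<And>i j. coeff (coeff f j) i \<noteq> 0 \<Longrightarrow> i + j \<le> n \<and> i + j \<noteq> n"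
    using f unfolding has_total_degree_def total_degree_le_def by blast
  then have "total_degree_le f (n - 1)"
    unfolding total_degree_le_def using n by (metis One_nat_def Suc_pred le_less less_Suc_eq_le less_le_trans zero_less_one)
  then obtain F' where F': "cone_extension \<phi> (n - 1) f F'"
    using cone_extension_exists[OF chart] by metis
  let ?a = "\<phi> (0, 0)"
  have a: "N \<bullet> ?a = 1" using range by auto
  have cont: "continuous_on UNIV (\<lambda>s. H (s *\<^sub>R ?a + V))" if "cone_extension \<phi> m f H" for m H
    by (rule continuous_on_compose2[of UNIV H])
      (use that in \<open>auto simp: cone_extension_def intro!: continuous_intros\<close>)
  have eq: "F (s *\<^sub>R ?a + V) = s * F' (s *\<^sub>R ?a + V)" if s: "s \<noteq> 0" for s
  proof -
    have "N \<bullet> ((1 / s) *\<^sub>R (s *\<^sub>R ?a + V)) = 1" using s a V(1) by (simp add: inner_add_right)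
    then obtain z where "\<phi> z = (1 / s) *\<^sub>R (s *\<^sub>R ?a + V)" using range by (metis (mono_tags) mem_Collect_eq imageE)
    then have "s *\<^sub>R ?a + V = s *\<^sub>R \<phi> z" using s by simp
    then have "F (s *\<^sub>R ?a + V) = s ^ n * poly2 f z" "F' (s *\<^sub>R ?a + V) = s ^ (n - 1) * poly2 f z"
      using F F' unfolding cone_extension_def by metis+
    moreover have "s ^ n = s * s ^ (n - 1)" using n by (simp flip: power_Suc)
    ultimately show ?thesis by simp
  qed
  have "F (0 *\<^sub>R ?a + V) = 0 * F' (0 *\<^sub>R ?a + V)"
  proof (rule continuous_eq_at_0[of "\<lambda>s. F (s *\<^sub>R ?a + V)" "\<lambda>s. s * F' (s *\<^sub>R ?a + V)" 0])
    show "continuous_on UNIV (\<lambda>s. F (s *\<^sub>R ?a + V))" by (rule cont[OF F])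
    show "continuous_on UNIV (\<lambda>s. s * F' (s *\<^sub>R ?a + V))"
      by (rule continuous_on_mult[OF continuous_on_id cont[OF F']])
  qed (rule eq)
  with V(2) show False by simp
qed

text \<open>
  Finitely many hyperplanes have measure zero and do not cover the space.
\<close>

lemma exists_nonorthogonal_vector:
  fixes S :: "('a::euclidean_space) set"
  assumes "finite S" "0 \<notin> S"
  obtains N where "\<And>P. P \<in> S \<Longrightarrow> N \<bullet> P \<noteq> 0"
proof -
  have "negligible (\<Union>P\<in>S. {N. P \<bullet> N = 0})"
    using assms by (intro negligible_Union) (auto intro!: negligible_hyperplane)
  then have "(\<Union>P\<in>S. {N. P \<bullet> N = 0}) \<noteq> UNIV" using non_negligible_UNIV by metis
  then obtain N where "N \<notin> (\<Union>P\<in>S. {N. P \<bullet> N = 0})" by blast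
  then show thesis using that[of N] by (auto simp: inner_commute)
qed

lemma projection_chart_exists:
  assumes N: "N \<noteq> 0" and euc: "G = Euclidean \<Longrightarrow> surface Euclidean = {X. N \<bullet> X = 1}"
  obtains \<phi> where "projection_chart G \<phi>" "range \<phi> = {X. N \<bullet> X = 1}"
proof -
  obtain u where u: "u \<noteq> 0" "N \<bullet> u = 0"
    using orthogonal_to_vector_exists[of N] unfolding orthogonal_def by auto
  define v where "v = cross3 N u"
  define a where "a = (1 / (N \<bullet> N)) *\<^sub>R N"
  have v: "N \<bullet> v = 0" by (simp add: v_def dot_cross_self)
  have a: "N \<bullet> a = 1" using N by (simp add: a_def)
  have "cross3 u v = (u \<bullet> u) *\<^sub>R N"
    unfolding v_def Lagrange using u by (simp add: inner_commute)
  then have uv: "cross3 u v \<noteq> 0" using u N by simp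
  define \<phi> where "\<phi> z = a + fst z *\<^sub>R u + snd z *\<^sub>R v" for z
  have "\<phi> z \<in> {X. N \<bullet> X = 1}" for z using a u v by (simp add: \<phi>_def inner_add_right)
  moreover have "X \<in> range \<phi>" if "N \<bullet> X = 1" for X
  proof -
    have "N \<bullet> (X - a) = 0" using that a by (simp add: inner_diff_right)
    from plane_coord_expansion[OF N u(2) v this uv]
    obtain r s where "X - a = r *\<^sub>R u + s *\<^sub>R v" by blast
    then have "X = \<phi> (r, s)" by (simp add: \<phi>_def algebra_simps)
    then show ?thesis by (rule range_eqI)
  qed
  ultimately have range: "range \<phi> = {X. N \<bullet> X = 1}" by blast
  have "inj \<phi>"
  proof (rule injI)
    fix z z' assume "\<phi> z = \<phi> z'"
    then have "fst z *\<^sub>R u + snd z *\<^sub>R v = fst z' *\<^sub>R u + snd z' *\<^sub>R v" by (simp add: \<phi>_def)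
    from independent_coefficients[OF uv this] show "z = z'" by (simp add: prod_eq_iff)
  qed
  moreover have "\<exists>a u v. \<forall>x y. \<phi> (x, y) = a + x *\<^sub>R u + y *\<^sub>R v" unfolding \<phi>_def by auto
  ultimately have "projection_chart G \<phi>"
    unfolding projection_chart_def using range euc by auto
  then show thesis using range by (rule that)
qed

text \<open>
  Let \<open>(x, y, z)\<close> be the coordinates with respect to \<open>A, B, C\<close>. On each of the planes \<open>x = 0\<close>,
  \<open>y = 0\<close>, \<open>z = 0\<close> the form to be constructed is prescribed, up to a factor, as a product of \<open>n\<close> linear
  factors. With suitable factors \<open>1\<close>, \<open>c\<close>, \<open>a\<close> these binary forms take the same value at each shared
  vertex: two of the three vertices determine \<open>c\<close> and \<open>a\<close>, and the condition on the product is
  agreement at the third. The sum of the three products then counts each of the terms \<open>a x\<^sup>n\<close>, \<open>y\<^sup>n\<close>,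
  \<open>c z\<^sup>n\<close> twice, and subtracting them once gives a form with the prescribed restrictions.

  The total degree of the resulting polynomial is exactly \<open>n\<close>: no \<open>P k\<close> lies in the plane \<open>N \<bullet> X = 0\<close>, so
  the form does not vanish where that plane meets the plane through \<open>B\<close> and \<open>C\<close>.
\<close>

lemma curve_exists:
  assumes D: "A \<bullet> cross3 B C \<noteq> 0" and n: "n \<ge> 1"
    and chart: "projection_chart G \<phi>" and range: "range \<phi> = {X. N \<bullet> X = 1}"
    and L: "span La = span {B, C}" "span Lb = span {C, A}" "span Lc = span {A, B}"
    and P: "\<And>k. k \<in> {1..n} \<Longrightarrow> P k = \<mu> k *\<^sub>R (t k *\<^sub>R B + C)"
    and Q: "\<And>k. k \<in> {1..n} \<Longrightarrow> Q k = \<mu>' k *\<^sub>R (t' k *\<^sub>R C + A)"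
    and R: "\<And>k. k \<in> {1..n} \<Longrightarrow> R k = \<mu>'' k *\<^sub>R (t'' k *\<^sub>R A + B)"
    and N: "\<And>k. k \<in> {1..n} \<Longrightarrow> N \<bullet> P k \<noteq> 0 \<and> N \<bullet> Q k \<noteq> 0 \<and> N \<bullet> R k \<noteq> 0"
    and prod: "(\<Prod>k=1..n. - t k) * (\<Prod>k=1..n. - t' k) * (\<Prod>k=1..n. - t'' k) = 1"
  obtains f where "has_total_degree f n"
    "lie_on_curve \<phi> f La n P" "lie_on_curve \<phi> f Lb n Q" "lie_on_curve \<phi> f Lc n R"
proof -
  let ?D = "A \<bullet> cross3 B C"
  define x y z where "x = (1 / ?D) *\<^sub>R cross3 B C" and "y = (1 / ?D) *\<^sub>R cross3 C A"
    and "z = (1 / ?D) *\<^sub>R cross3 A B"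
  have xyz: "x \<bullet> (r *\<^sub>R A + s *\<^sub>R B + w *\<^sub>R C) = r"
    "y \<bullet> (r *\<^sub>R A + s *\<^sub>R B + w *\<^sub>R C) = s"
    "z \<bullet> (r *\<^sub>R A + s *\<^sub>R B + w *\<^sub>R C) = w" for r s w
    using frame_coordinates[OF D, of r s w] by (simp_all add: x_def y_def z_def)
  define c a where "c = (\<Prod>k=1..n. - t k)" and "a = c * (\<Prod>k=1..n. - t' k)"
  have ac: "a * (\<Prod>k=1..n. - t'' k) = 1" using prod by (simp add: a_def c_def)
  then have "a \<noteq> 0" by (metis mult_zero_left zero_neq_one)
  then have nz: "a \<noteq> 0" "c \<noteq> 0" unfolding a_def by (metis, metis mult_zero_left)
  define F where "F X = (((((1 * (\<Prod>k=1..n. (y - t k *\<^sub>R z) \<bullet> X) +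
      c * (\<Prod>k=1..n. (z - t' k *\<^sub>R x) \<bullet> X)) + a * (\<Prod>k=1..n. (x - t'' k *\<^sub>R y) \<bullet> X)) +
      (- a) * (\<Prod>k=1..n. x \<bullet> X)) + (- 1) * (\<Prod>k=1..n. y \<bullet> X)) + (- c) * (\<Prod>k=1..n. z \<bullet> X))" for X
  have "polynomial_form \<phi> n F"
    unfolding F_def by (intro polynomial_form_add polynomial_form_prod_linear[OF chart])
  then obtain f where f: "total_degree_le f n" and cone: "cone_extension \<phi> n f F"
    unfolding polynomial_form_def by blast
  have F_eq: "F (r *\<^sub>R A + s *\<^sub>R B + w *\<^sub>R C) = (\<Prod>k=1..n. s - t k * w) +
      c * (\<Prod>k=1..n. w - t' k * r) + a * (\<Prod>k=1..n. r - t'' k * s) - a * r ^ n - s ^ n - c * w ^ n" for r s w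
    by (simp add: F_def inner_diff_left xyz)
  have scaled: "(\<Prod>k=1..n. - (g k * r)) = (\<Prod>k=1..n. - g k) * r ^ n" for g and r :: real
  proof -
    have "(\<Prod>k=1..n. - (g k * r)) = (\<Prod>k=1..n. - g k * r)" by simp
    then show ?thesis unfolding prod.distrib by simp
  qed
  \<comment> \<open>On a side the coordinate of the opposite vertex is zero, and so must be its \<open>n\<close>-th power.\<close>
  have n0: "(0::real) ^ n = 0" using n by simp
  have BC: "F (s *\<^sub>R B + w *\<^sub>R C) = 1 * (\<Prod>k=1..n. s - t k * w)" for s w
    using F_eq[of 0 s w] ac
    by (simp add: scaled n0 mult.assoc[symmetric] del: One_nat_def)
  have CA: "F (w *\<^sub>R C + r *\<^sub>R A) = c * (\<Prod>k=1..n. w - t' k * r)" for w r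
    using F_eq[of r 0 w] by (simp add: scaled n0 c_def[symmetric] add.commute del: One_nat_def)
  have AB: "F (r *\<^sub>R A + s *\<^sub>R B) = a * (\<Prod>k=1..n. r - t'' k * s)" for r s
    using F_eq[of r s 0] 
    by (simp add: scaled n0 c_def[symmetric] a_def[symmetric] mult.assoc[symmetric] del: One_nat_def)
  have "B \<bullet> cross3 C A = ?D" "C \<bullet> cross3 A B = ?D"
    by (simp_all add: cross3_def inner_vec_def sum_3 algebra_simps)
  then have indep: "cross3 B C \<noteq> 0" "cross3 C A \<noteq> 0" "cross3 A B \<noteq> 0" using D by auto
  have "\<exists>z. central_projection (range \<phi>) p (\<phi> z)" if "N \<bullet> p \<noteq> 0" for p
  proof -
    have "(1 / (N \<bullet> p)) *\<^sub>R p \<in> range \<phi>" using that unfolding range by simp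
    then obtain z where z: "\<phi> z = (1 / (N \<bullet> p)) *\<^sub>R p" by (metis imageE)
    then have "\<phi> z \<in> span {p}" by (simp add: span_base span_scale)
    then have "central_projection (range \<phi>) p (\<phi> z)" unfolding central_projection_def by simp
    then show ?thesis ..
  qed
  then obtain q where q: "\<And>p. N \<bullet> p \<noteq> 0 \<Longrightarrow> central_projection (range \<phi>) p (\<phi> (q p))" by metis
  note iff = lie_on_curve_iff[OF chart cone f n]
  have "lie_on_curve \<phi> f La n P"
  proof (rule iffD2[OF iff[where q = "\<lambda>k. q (P k)", OF indep(1) L(1) P]])
    show "\<exists>c. c \<noteq> 0 \<and> (\<forall>s w. F (s *\<^sub>R B + w *\<^sub>R C) = c * (\<Prod>k=1..n. s - t k * w))"
      using BC by (intro exI[of _ 1]) simp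
  qed (use q N in blast)+
  moreover have "lie_on_curve \<phi> f Lb n Q"
  proof (rule iffD2[OF iff[where q = "\<lambda>k. q (Q k)", OF indep(2) L(2) Q]])
    show "\<exists>c. c \<noteq> 0 \<and> (\<forall>w r. F (w *\<^sub>R C + r *\<^sub>R A) = c * (\<Prod>k=1..n. w - t' k * r))"
      using CA nz by (intro exI[of _ c]) simp
  qed (use q N in blast)+
  moreover have "lie_on_curve \<phi> f Lc n R"
  proof (rule iffD2[OF iff[where q = "\<lambda>k. q (R k)", OF indep(3) L(3) R]])
    show "\<exists>c. c \<noteq> 0 \<and> (\<forall>r s. F (r *\<^sub>R A + s *\<^sub>R B) = c * (\<Prod>k=1..n. r - t'' k * s))"
      using AB nz by (intro exI[of _ a]) simp
  qed (use q N in blast)+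
  moreover have "has_total_degree f n"
  proof (rule has_total_degree_if_nonzero_at_infinity[OF chart range f cone n])
    \<comment> \<open>The direction in which the plane through \<open>B\<close> and \<open>C\<close> meets \<open>N \<bullet> X = 0\<close>.\<close>
    let ?V = "(N \<bullet> C) *\<^sub>R B + (- (N \<bullet> B)) *\<^sub>R C"
    show "N \<bullet> ?V = 0" by (simp add: inner_add_right inner_diff_right)
    have "(N \<bullet> C) - t k * (- (N \<bullet> B)) \<noteq> 0" if k: "k \<in> {1..n}" for k
      using N[OF k] P[OF k] by (auto simp: inner_add_right add.commute)
    then show "F ?V \<noteq> 0" unfolding BC by (simp add: prod_zero_iff)
  qed
  ultimately show thesis by (intro that)
qed

section \<open>The theorem of Menelaus for curves of degree n\<close>

theorem theorem15:
  fixes G :: geometry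
    and n :: nat
    and A B C :: "real^3"
    and \<alpha> \<beta> \<gamma> :: "real \<Rightarrow> real^3"
    and As Bs Cs :: "nat \<Rightarrow> real^3"
  assumes "n \<ge> 1"
    and "is_triangle G A B C"
    and "oriented_line G \<alpha>" and "{B, C} \<subseteq> range \<alpha>"
    and "oriented_line G \<beta>" and "{A, C} \<subseteq> range \<beta>"
    and "oriented_line G \<gamma>" and "{A, B} \<subseteq> range \<gamma>"
    and "\<forall>k\<in>{1..n}. As k \<in> range \<alpha> \<and> Bs k \<in> range \<beta> \<and> Cs k \<in> range \<gamma>"
    and denominators: "\<forall>k\<in>{1..n}. gsin_along G \<beta> (Bs k) C \<noteq> 0 \<and>
           gsin_along G \<gamma> (Cs k) A \<noteq> 0 \<and> gsin_along G \<alpha> (As k) B \<noteq> 0"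
  shows "(\<exists>\<phi> f. curve_of_degree G n \<phi> f \<and>
             lie_on_curve \<phi> f (range \<alpha>) n As \<and>
             lie_on_curve \<phi> f (range \<beta>) n Bs \<and>
             lie_on_curve \<phi> f (range \<gamma>) n Cs)
     \<longleftrightarrow> (\<Prod>k=1..n.
             (gsin_along G \<beta> A (Bs k) / gsin_along G \<beta> (Bs k) C) *
             (gsin_along G \<gamma> B (Cs k) / gsin_along G \<gamma> (Cs k) A) *
             (gsin_along G \<alpha> C (As k) / gsin_along G \<alpha> (As k) B)) = (- 1) ^ n"
proof -
  define ta tb tc where "ta k = gsin_along G \<alpha> C (As k) / gsin_along G \<alpha> (As k) B"
    and "tb k = gsin_along G \<beta> A (Bs k) / gsin_along G \<beta> (Bs k) C"
    and "tc k = gsin_along G \<gamma> B (Cs k) / gsin_along G \<gamma> (Cs k) A" for k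
  have D: "A \<bullet> cross3 B C \<noteq> 0" using triangle_det[OF assms(2)] .
  have "B \<bullet> cross3 C A = A \<bullet> cross3 B C" "C \<bullet> cross3 A B = A \<bullet> cross3 B C"
    by (simp_all add: cross3_def inner_vec_def sum_3 algebra_simps)
  then have indep: "cross3 B C \<noteq> 0" "cross3 C A \<noteq> 0" "cross3 A B \<noteq> 0" using D by auto
  have CA: "{C, A} \<subseteq> range \<beta>" using assms(6) by simp
  have L: "span (range \<alpha>) = span {B, C}" "span (range \<beta>) = span {C, A}"
    "span (range \<gamma>) = span {A, B}"
    using oriented_line_plane assms(3,4,5,7,8) CA indep by blast+
  have "\<exists>\<mu>. As k = \<mu> *\<^sub>R (ta k *\<^sub>R B + C)" if "k \<in> {1..n}" for k
    using gsin_ratio[OF assms(3,4) _ indep(1), of "As k"] assms(9) denominators that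
    unfolding ta_def by metis
  then obtain \<mu>a where As: "\<And>k. k \<in> {1..n} \<Longrightarrow> As k = \<mu>a k *\<^sub>R (ta k *\<^sub>R B + C)" by metis
  have "\<exists>\<mu>. Bs k = \<mu> *\<^sub>R (tb k *\<^sub>R C + A)" if "k \<in> {1..n}" for k
    using gsin_ratio[OF assms(5) CA _ indep(2), of "Bs k"] assms(9) denominators that
    unfolding tb_def by metis
  then obtain \<mu>b where Bs: "\<And>k. k \<in> {1..n} \<Longrightarrow> Bs k = \<mu>b k *\<^sub>R (tb k *\<^sub>R C + A)" by metis
  have "\<exists>\<mu>. Cs k = \<mu> *\<^sub>R (tc k *\<^sub>R A + B)" if "k \<in> {1..n}" for k
    using gsin_ratio[OF assms(7,8) _ indep(3), of "Cs k"] assms(9) denominators that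
    unfolding tc_def by metis
  then obtain \<mu>c where Cs: "\<And>k. k \<in> {1..n} \<Longrightarrow> Cs k = \<mu>c k *\<^sub>R (tc k *\<^sub>R A + B)" by metis
  have neg: "(\<Prod>k=1..n. - g k) = (- 1) ^ n * (\<Prod>k=1..n. g k)" for g :: "nat \<Rightarrow> real"
    using prod.distrib[of "\<lambda>k. - 1" g "{1..n}"] by simp
  have "(\<Prod>k=1..n. - ta k) * (\<Prod>k=1..n. - tb k) * (\<Prod>k=1..n. - tc k)
      = (- 1) ^ n * (\<Prod>k=1..n. tb k * tc k * ta k)"
  proof -
    have "((- 1 :: real) ^ n) * (- 1) ^ n = 1" by (simp flip: power_mult_distrib)
    then show ?thesis unfolding neg prod.distrib by (simp add: ac_simps) 
  qed
  moreover have "(- 1 :: real) ^ n * p = 1 \<longleftrightarrow> p = (- 1) ^ n" for p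
    by (cases "even n") auto
  ultimately have prod_iff: "(\<Prod>k=1..n. tb k * tc k * ta k) = (- 1) ^ n \<longleftrightarrow>
      (\<Prod>k=1..n. - ta k) * (\<Prod>k=1..n. - tb k) * (\<Prod>k=1..n. - tc k) = 1"
    by simp
  have "(\<exists>\<phi> f. curve_of_degree G n \<phi> f \<and>
             lie_on_curve \<phi> f (range \<alpha>) n As \<and>
             lie_on_curve \<phi> f (range \<beta>) n Bs \<and>
             lie_on_curve \<phi> f (range \<gamma>) n Cs)
     \<longleftrightarrow> (\<Prod>k=1..n. - ta k) * (\<Prod>k=1..n. - tb k) * (\<Prod>k=1..n. - tc k) = 1"
  proof
    assume "\<exists>\<phi> f. curve_of_degree G n \<phi> f \<and>
             lie_on_curve \<phi> f (range \<alpha>) n As \<and>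
             lie_on_curve \<phi> f (range \<beta>) n Bs \<and>
             lie_on_curve \<phi> f (range \<gamma>) n Cs"
    then obtain \<phi> f where chart: "projection_chart G \<phi>" and f: "total_degree_le f n"
      and lie: "lie_on_curve \<phi> f (range \<alpha>) n As" "lie_on_curve \<phi> f (range \<beta>) n Bs"
        "lie_on_curve \<phi> f (range \<gamma>) n Cs"
      unfolding curve_of_degree_def has_total_degree_def total_degree_le_def by blast
    obtain F where F: "cone_extension \<phi> n f F" using cone_extension_exists[OF chart f] .
    note vertex = lie_on_curve_vertex_values[OF chart F f assms(1)]
    have "F C = F B * (\<Prod>k=1..n. - ta k)" "F A = F C * (\<Prod>k=1..n. - tb k)"
      "F B = F A * (\<Prod>k=1..n. - tc k)" "F B \<noteq> 0"
      using vertex[OF indep(1) L(1) As lie(1)] vertex[OF indep(2) L(2) Bs lie(2)]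
        vertex[OF indep(3) L(3) Cs lie(3)] by blast+
    then have "F B * ((\<Prod>k=1..n. - ta k) * (\<Prod>k=1..n. - tb k) * (\<Prod>k=1..n. - tc k)) = F B * 1"
      by (metis mult.assoc mult.right_neutral)
    then show "(\<Prod>k=1..n. - ta k) * (\<Prod>k=1..n. - tb k) * (\<Prod>k=1..n. - tc k) = 1"
      using \<open>F B \<noteq> 0\<close> mult_left_cancel by blast
  next
    assume prod: "(\<Prod>k=1..n. - ta k) * (\<Prod>k=1..n. - tb k) * (\<Prod>k=1..n. - tc k) = 1"
    let ?S = "As ` {1..n} \<union> Bs ` {1..n} \<union> Cs ` {1..n}"
    have "range \<alpha> \<subseteq> surface G" "range \<beta> \<subseteq> surface G" "range \<gamma> \<subseteq> surface G"
      using assms(3,5,7) unfolding oriented_line_def is_line_def by auto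
    then have S: "?S \<subseteq> surface G" using assms(9) by blast
    have "0 \<notin> surface G" by (cases G) auto
    then have "0 \<notin> ?S" using S by blast
    have "\<exists>N. (\<forall>X\<in>?S. N \<bullet> X \<noteq> 0) \<and> (G = Euclidean \<longrightarrow> surface Euclidean = {X. N \<bullet> X = 1})"
    proof (cases "G = Euclidean")
      case True
      \<comment> \<open>The Euclidean plane has to be its own chart, but it contains all the points.\<close>
      have "axis 3 1 \<bullet> X = X $ 3" for X :: "real^3" by (simp add: inner_axis')
      then show ?thesis using S True by (intro exI[of _ "axis 3 1"]) auto
    next
      case False
      have "finite ?S" by simp
      then obtain N where "\<And>X. X \<in> ?S \<Longrightarrow> N \<bullet> X \<noteq> 0"
        using exists_nonorthogonal_vector \<open>0 \<notin> ?S\<close> by metis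
      then show ?thesis using False by blast
    qed
    then obtain N where N: "\<forall>X\<in>?S. N \<bullet> X \<noteq> 0"
      and euc: "G = Euclidean \<longrightarrow> surface Euclidean = {X. N \<bullet> X = 1}" by (elim exE conjE)
    have "As 1 \<in> ?S" using assms(1) by simp
    then have "N \<noteq> 0" using N by (metis inner_zero_left)
    obtain \<phi> where chart: "projection_chart G \<phi>" and range: "range \<phi> = {X. N \<bullet> X = 1}"
      using projection_chart_exists[OF \<open>N \<noteq> 0\<close> mp[OF euc]] .
    have N': "N \<bullet> As k \<noteq> 0 \<and> N \<bullet> Bs k \<noteq> 0 \<and> N \<bullet> Cs k \<noteq> 0" if "k \<in> {1..n}" for k
      using N that by blast
    obtain f where "has_total_degree f n" "lie_on_curve \<phi> f (range \<alpha>) n As"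
      "lie_on_curve \<phi> f (range \<beta>) n Bs" "lie_on_curve \<phi> f (range \<gamma>) n Cs"
      using curve_exists[OF D assms(1) chart range L As Bs Cs N' prod] .
    then show "\<exists>\<phi> f. curve_of_degree G n \<phi> f \<and>
             lie_on_curve \<phi> f (range \<alpha>) n As \<and>
             lie_on_curve \<phi> f (range \<beta>) n Bs \<and>
             lie_on_curve \<phi> f (range \<gamma>) n Cs"
      using chart unfolding curve_of_degree_def by blast
  qed
  then show ?thesis unfolding prod_iff[symmetric] unfolding ta_def tb_def tc_def .
qed

end
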